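(* Let $\{I_i\}_{0\le i<n}$ be a realization of the abstract continued fraction $\mathcal{A}$, and let $\{H_i\}$, $\{K_i\}$, $\mathcal{F}$, $F$ (and, for the dual, $\mathcal{F}^\sharp$, $F^\sharp$) be the associated attractors and maps. Given $\omega_0\in\bigl(\bigcup_iH_i\bigr)\setminus(\mathbb{Q}\cup\{\infty\})$, the following statements are equivalent. (i) At least one of the $F$-orbits of $\omega_0$ is purely periodic. (ii) $\omega_0$ has precisely one $F$-orbit, and that orbit is purely periodic. (iii) $\omega_0$ is a quadratic irrational and for some $i_0$ we have $\omega_0\in H_{i_0}$ and $\omega_0'\in K_{i_0}$, where $\omega_0'$ is the Galois conjugate of $\omega_0$. If this happens, then the symbolic periods of $(i_0,\omega_0)$ under $\mathcal{F}$ and of $(i_0,\omega_0')$ under $\mathcal{F}^\sharp$ are unique and the reverse of each other. If moreover the realization is geometric, then $\omega_0'$ has a unique purely periodic $F^\sharp$-orbit, of the same period $p$ as the $F$-orbit of $\omega_0$, and the identity $(F^\sharp)^t(\omega_0')=\bigl(F^{-t}(\omega_0)\bigr)'$ holds for every $t\pmod p$ (powers of $F$ and $F^\sharp$ being taken along these periodic orbits).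
   Context: **Codes.** $\Sigma$ is the monoid generated by $l,n,f$ modulo $fl=nf$, $fn=lf$, $ff=\epsilon$ (identity). Every $\sigma\in\Sigma$ is uniquely a free word $w$ in $l,n$, possibly followed by a single $f$; $\ell(\sigma)$ is the length of $w$. $\sharp$ is the involutive antiautomorphism of $\Sigma$ with $l^\sharp=n$, $n^\sharp=l$, $f^\sharp=f$. Given nodes $\{0,\ldots,n-1\}$, $n\ge1$ (the integer $n$ is not to be confused with the letter $n$), let $\widetilde\Sigma=\{i\sigma j:\sigma\in\Sigma,\ i,j \text{ nodes}\}$ with partial product $(i\sigma j)(j\tau k)=i\sigma\tau k$ (undefined when the inner nodes differ), $\ell(i\sigma j)=\ell(\sigma)$, $(i\sigma j)^\sharp=j\sigma^\sharp i$. A code is a subset $\mathcal{A}\subset\widetilde\Sigma$ such that whenever two products $a_1\cdots a_r$ and $b_1\cdots b_s$ of elements of $\mathcal{A}$ are defined and equal in $\widetilde\Sigma$, then $r=s$ and $a_k=b_k$ for all $k$. For finite $\mathcal{A}$, $\mathcal{G}_{\mathcal{A}}$ is the directed graph on the nodes whose set of edges from $i$ to $j$ is $E_{ij}=\{\text{elements of }\mathcal{A}\text{ of the form }i\sigma j\}$; $E_i^\omega$ is the set of infinite paths starting at $i$, and $E^\omega=\bigcup_iE_i^\omega$. $G_{\mathcal{A}}$ is the $n\times n$ matrix with $ij$-entry $\sum_{a\in E_{ij}}2^{-\ell(a)}$. An abstract continued fraction is a finite code $\mathcal{A}$ with $\mathcal{G}_{\mathcal{A}}$ strongly connected and $G_{\mathcal{A}}$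 of spectral radius $1$. Then $\mathcal{A}^\sharp=\{a^\sharp:a\in\mathcal{A}\}$ is again one. **Intervals and maps.** Matrices act on $\mathrm{P}^1\mathbb{R}=\mathbb{R}\cup\{\infty\}$ by Möbius maps; $\mathrm{PSL}_2^\pm\mathbb{Z}$ is the group of integer $2\times2$ matrices of determinant $\pm1$ modulo $\pm1$. $\mathrm{Proj}:\Sigma\to\mathrm{PSL}^\pm_2\mathbb{Z}$ is the monoid homomorphism with $l\mapsto\begin{bmatrix}1&0\\1&1\end{bmatrix}$, $n\mapsto\begin{bmatrix}1&1\\0&1\end{bmatrix}$, $f\mapsto\begin{bmatrix}0&1\\1&0\end{bmatrix}$. Unimodular intervals are the images of $[0,\infty]$ under elements of $\mathrm{PSL}_2\mathbb{Z}$; the matrix $\begin{bmatrix}p'&p\\ q'&q\end{bmatrix}$ corresponds bijectively to the closed interval $[p/q,p'/q']$ going counterclockwise (in the increasing direction, possibly through $\infty$) from $p/q$ to $p'/q'$; the same letter denotes interval and matrix. With $S_0=\begin{bmatrix}0&-1\\1&0\end{bmatrix}$, $IS_0$ is the complementary interval of $I$. Fix unimodular intervals $I_0,\ldots,I_{n-1}$, one per node. For $a=i\sigma j\in\mathcal{A}$ put $B_a=I_i\,\mathrm{Proj}(\sigma)I_j^{-1}:I_j\to I_i$ and $D_a=B_a^{-1}:I_iS_0\to I_jS_0$. Juxtaposed indices denote products: $B_{a_0\ldots a_{t-1}}=B_{a_0}\cdots B_{a_{t-1}}$, similarly for $D$. **Attractors.** For $\mathbf{a}=a_0a_1\ldots\in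 E_{i_0}^\omega$ with $a_t=i_t\sigma_ti_{t+1}$, $\pi(\mathbf{a})$ is the unique point of $\bigcap_{t\ge0}B_{a_0\ldots a_{t-1}}I_{i_t}$, and $H_i=\pi[E_i^\omega]\subseteq I_i$. Dually, $(E^\sharp)^\omega_i$ is the set of sequences $a_0a_1\ldots$ in $\mathcal{A}$ with $a_t=i_{t+1}\sigma_ti_t$ and $i_0=i$ (paths following edges of $\mathcal{G}_{\mathcal{A}}$ in reverse); for such a sequence $\pi$ denotes the unique point of $\bigcap_tD_{a_0\ldots a_{t-1}}I_{i_t}S_0$, and $K_i=\pi[(E^\sharp)_i^\omega]\subseteq I_iS_0$. **Gauss-type maps.** $\mathcal{F}$ is the multivalued map on the disjoint union $\bigsqcup_iH_i=\{(i,x):x\in H_i\}$ conjugate via $\pi$ to the shift: the images of $(i,x)$ are the $(j,B_a^{-1}(x))$ for those $a\in E_{ij}$ such that $B_a^{-1}$ acts on $(i,x)$, i.e. $x=\pi(\mathbf{a})$ for some $\mathbf{a}\in E_i^\omega$ with $a_0=a$ (equivalently $B_a^{-1}(x)\in H_j$). $\{I_i\}$ is a realization of $\mathcal{A}$ if, whenever $x\in H_i\cap H_j$ (as points of $\mathrm{P}^1\mathbb{R}$), the set $\{B_a^{-1}(x):B_a^{-1}\text{ acts on }(i,x)\}$ equals $\{B_b^{-1}(x):B_b^{-1}\text{ acts on }(j,x)\}$ as subsets of $\mathrm{P}^1\mathbb{R}$; then $\mathcal{F}$ descends to a multivalued map $F$ on $\bigcup_iH_i\subseteq\mathrm{P}^1\mathbb{R}$.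 Dually, $\mathcal{F}^\sharp$ on $\bigsqcup_iK_i$ sends $(i,y)$ to the points $(j,D_a^{-1}(y))$ with $a\in E_{ji}$ and $D_a^{-1}(y)\in K_j$; if $\{I_iS_0\}$ is a realization of $\mathcal{A}^\sharp$ it descends to $F^\sharp$ on $\bigcup_iK_i$. The realization $\{I_i\}$ of $\mathcal{A}$ is geometric if also $\{I_iS_0\}$ is a realization of $\mathcal{A}^\sharp$. **Orbits.** An $F$-orbit of $x_0$ is a sequence $x_0,x_1,\ldots$ with $x_{t+1}$ one of the $F$-images of $x_t$; equivalently, $x_t=\pi(S^t\mathbf{a})$ for some $\mathbf{a}\in E^\omega$ with $\pi(\mathbf{a})=x_0$, $S$ being the shift. It is purely periodic if $x_{t+p}=x_t$ for some $p\ge1$ and all $t$. $\mathbf{a}\in E_i^\omega$ is a symbolic orbit of $(i,\pi(\mathbf{a}))$ under $\mathcal{F}$; if $\mathbf{a}=(a_0\ldots a_{p-1})^\omega$ with $p\ge1$ minimal, then $a_0\ldots a_{p-1}$ is the symbolic period. Same for $F^\sharp$, $\mathcal{F}^\sharp$, using $(E^\sharp)^\omega$. $F^{-t}(\omega_0)$ denotes the point $t$ steps back along the purely periodic $F$-orbit of $\omega_0$; $'$ is Galois conjugation. *)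

theory Defs
  imports
    "HOL-Analysis.Determinants"
    "HOL-Computational_Algebra.Polynomial"
    "Jordan_Normal_Form.Spectral_Radius"
    "Graph_Theory.Digraph_Component"
begin

no_notation vec_index (infixl "$" 100)
hide_const (open) Matrix.mat Determinant.det

section \<open>The monoid of words in l, n, f\<close>

datatype letter = Let_l | Let_n

fun swap_letter :: "letter \<Rightarrow> letter" where
  "swap_letter Let_l = Let_n"
| "swap_letter Let_n = Let_l"

text \<open>
  The monoid with generators l, n, f and relations fl = nf, fn = lf, ff = 1 is modelled by
  its normal forms: \<open>Sg w e\<close> is the free word \<open>w\<close> in l, n, followed by f iff \<open>e\<close> holds.
  The relations say that moving f past a word exchanges l and n.  The lemmas
  \<open>sg_relations\<close> and \<open>sg_universal\<close> below show that this is the presented monoid.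
\<close>

datatype sg = Sg (sg_word: "letter list") (sg_flip: bool)

instantiation sg :: monoid_mult
begin

definition one_sg :: sg where "1 = Sg [] False"

fun times_sg :: "sg \<Rightarrow> sg \<Rightarrow> sg" where
  "Sg u e * Sg v d = Sg (u @ (if e then map swap_letter v else v)) (e \<noteq> d)"

lemma swap_letter_swap [simp]: "swap_letter (swap_letter x) = x"
  by (cases x) auto

lemma swap_letter_comp [simp]: "swap_letter \<circ> swap_letter = id"
  by (auto simp: fun_eq_iff)

instance
proof
  fix a b c :: sg
  show "a * b * c = a * (b * c)" by (cases a; cases b; cases c) auto
  show "1 * a = a" "a * 1 = a" by (cases a; simp add: one_sg_def)+
qed

end

definition sg_l :: sg where "sg_l = Sg [Let_l] False"
definition sg_n :: sg where "sg_n = Sg [Let_n] False"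
definition sg_f :: sg where "sg_f = Sg [] True"

lemma sg_relations: "sg_f * sg_l = sg_n * sg_f" "sg_f * sg_n = sg_l * sg_f" "sg_f * sg_f = 1"
  by (simp_all add: sg_l_def sg_n_def sg_f_def one_sg_def)

lemma sg_universal:
  fixes x y z :: "'m::monoid_mult"
  assumes "z * x = y * z" "z * y = x * z" "z * z = 1"
  shows "\<exists>!h :: sg \<Rightarrow> 'm. h 1 = 1 \<and> (\<forall>a b. h (a * b) = h a * h b) \<and>
           h sg_l = x \<and> h sg_n = y \<and> h sg_f = z"
proof -
  define c where "c = (\<lambda>q. case q of Let_l \<Rightarrow> x | Let_n \<Rightarrow> y)"
  define g where "g w = prod_list (map c w)" for w
  define h where "h a = (case a of Sg w e \<Rightarrow> g w * (if e then z else 1))" for a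
  have zc: "z * c q = c (swap_letter q) * z" for q
    using assms by (cases q) (auto simp: c_def)
  have zg: "z * g w = g (map swap_letter w) * z" for w
  proof (induction w)
    case (Cons q w)
    have "z * g (q # w) = (z * c q) * g w" by (simp add: g_def mult.assoc)
    also have "\<dots> = c (swap_letter q) * (z * g w)" by (simp add: zc mult.assoc)
    finally show ?case using Cons by (simp add: g_def mult.assoc)
  qed (simp add: g_def)
  have gapp: "g (u @ v) = g u * g v" for u v by (simp add: g_def)
  have hm: "h (a * b) = h a * h b" for a b
  proof -
    obtain u e v d where ab: "a = Sg u e" "b = Sg v d" by (cases a; cases b) auto
    show ?thesis
    proof (cases e)
      case False
      then show ?thesis by (simp add: ab h_def gapp mult.assoc)
    next
      case True
      have "h a * h b = g u * (z * g v) * (if d then z else 1)"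
        by (simp add: ab h_def True mult.assoc)
      also have "\<dots> = g u * g (map swap_letter v) * (z * (if d then z else 1))"
        by (simp add: zg mult.assoc)
      also have "\<dots> = h (a * b)" by (simp add: ab h_def gapp True assms(3) mult.assoc)
      finally show ?thesis by simp
    qed
  qed
  show ?thesis
  proof (intro ex1I conjI allI)
    show "h 1 = 1" by (simp add: h_def one_sg_def g_def)
    show "h (a * b) = h a * h b" for a b by (rule hm)
    show "h sg_l = x" "h sg_n = y" "h sg_f = z"
      by (simp_all add: h_def g_def c_def sg_l_def sg_n_def sg_f_def)
  next
    fix k :: "sg \<Rightarrow> 'm"
    assume k: "k 1 = 1 \<and> (\<forall>a b. k (a * b) = k a * k b) \<and> k sg_l = x \<and> k sg_n = y \<and> k sg_f = z"
    have kq: "k (Sg [q] False) = c q" for q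
      using k by (cases q) (auto simp: c_def sg_l_def sg_n_def)
    have kw: "k (Sg w False) = g w" for w
    proof (induction w)
      case Nil
      then show ?case using k by (simp add: g_def one_sg_def)
    next
      case (Cons q w)
      have "Sg (q # w) False = Sg [q] False * Sg w False" by simp
      then show ?case using Cons k kq by (metis g_def list.simps(9) prod_list.Cons)
    qed
    show "k = h"
    proof
      fix a
      obtain w e where a: "a = Sg w e" by (cases a)
      have "Sg w True = Sg w False * sg_f" by (simp add: sg_f_def)
      then have "k (Sg w True) = g w * z" using k kw by metis
      then show "k a = h a" using kw by (cases e) (simp_all add: a h_def)
    qed
  qed
qed

definition sg_len :: "sg \<Rightarrow> nat" where "sg_len a = length (sg_word a)"

text \<open>
  \<open>(w f)\<^sup>\<sharp> = f w\<^sup>\<sharp>\<close>, and moving f to the right undoes the exchange of l and n in \<open>w\<^sup>\<sharp>\<close>.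
\<close>

fun sg_sharp :: "sg \<Rightarrow> sg" where
  "sg_sharp (Sg w e) = Sg (rev (if e then w else map swap_letter w)) e"

lemma sg_sharp_generators: "sg_sharp sg_l = sg_n" "sg_sharp sg_n = sg_l" "sg_sharp sg_f = sg_f"
  by (simp_all add: sg_l_def sg_n_def sg_f_def)

lemma sg_sharp_mult: "sg_sharp (a * b) = sg_sharp b * sg_sharp a"
  by (cases a; cases b) (auto simp: rev_map)

lemma sg_sharp_sharp: "sg_sharp (sg_sharp a) = a"
  by (cases a) (auto simp: rev_map)


section \<open>Codes and abstract continued fractions\<close>

text \<open>\<open>(i, s, j)\<close> stands for \<open>i s j\<close>, and is an edge from \<open>i\<close> to \<open>j\<close>.\<close>

type_synonym edge = "nat \<times> sg \<times> nat"

definition src :: "edge \<Rightarrow> nat" where "src a = fst a"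
definition lab :: "edge \<Rightarrow> sg" where "lab a = fst (snd a)"
definition tgt :: "edge \<Rightarrow> nat" where "tgt a = snd (snd a)"

definition Sigma_tilde :: "nat \<Rightarrow> edge set" where
  "Sigma_tilde n = {a. src a < n \<and> tgt a < n}"

definition edge_mult :: "edge \<Rightarrow> edge \<Rightarrow> edge option" where
  "edge_mult a b = (if tgt a = src b then Some (src a, lab a * lab b, tgt b) else None)"

fun edge_prod :: "edge list \<Rightarrow> edge option" where
  "edge_prod [] = None"
| "edge_prod [a] = Some a"
| "edge_prod (a # b # as) = Option.bind (edge_prod (b # as)) (edge_mult a)"

definition edge_sharp :: "edge \<Rightarrow> edge" where
  "edge_sharp a = (tgt a, sg_sharp (lab a), src a)"

definition is_code :: "nat \<Rightarrow> edge set \<Rightarrow> bool" where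
  "is_code n A \<longleftrightarrow> A \<subseteq> Sigma_tilde n \<and>
     (\<forall>as bs c. set as \<subseteq> A \<longrightarrow> set bs \<subseteq> A \<longrightarrow>
        edge_prod as = Some c \<longrightarrow> edge_prod bs = Some c \<longrightarrow> as = bs)"

definition code_graph :: "nat \<Rightarrow> edge set \<Rightarrow> (nat, edge) pre_digraph" where
  "code_graph n A = \<lparr>verts = {..<n}, arcs = A, tail = src, head = tgt\<rparr>"

definition code_matrix :: "nat \<Rightarrow> edge set \<Rightarrow> complex mat" where
  "code_matrix n A = Matrix.mat n n (\<lambda>(i, j).
     \<Sum>a \<in> {a \<in> A. src a = i \<and> tgt a = j}. (1 / 2) ^ sg_len (lab a))"

definition abstract_cf :: "nat \<Rightarrow> edge set \<Rightarrow> bool" where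
  "abstract_cf n A \<longleftrightarrow> n \<ge> 1 \<and> finite A \<and> is_code n A \<and>
     strongly_connected (code_graph n A) \<and> spectral_radius (code_matrix n A) = 1"

definition paths :: "edge set \<Rightarrow> nat \<Rightarrow> (nat \<Rightarrow> edge) set" where
  "paths A i = {a. (\<forall>t. a t \<in> A) \<and> src (a 0) = i \<and> (\<forall>t. tgt (a t) = src (a (Suc t)))}"

text \<open>\<open>rev_paths A i\<close> is \<open>(E\<^sup>\<sharp>)\<^sup>\<omega>\<^sub>i\<close>: sequences in \<open>A\<close> itself, following edges backwards from \<open>i\<close>.\<close>

definition rev_paths :: "edge set \<Rightarrow> nat \<Rightarrow> (nat \<Rightarrow> edge) set" where
  "rev_paths A i = {a. (\<forall>t. a t \<in> A) \<and> tgt (a 0) = i \<and> (\<forall>t. src (a t) = tgt (a (Suc t)))}"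


section \<open>The projective line and unimodular intervals\<close>

datatype p1 = Fin real | Infty

definition mat22 :: "int \<Rightarrow> int \<Rightarrow> int \<Rightarrow> int \<Rightarrow> int^2^2" where
  "mat22 a b c d = vector [vector [a, b], vector [c, d]]"

fun mobius :: "int^2^2 \<Rightarrow> p1 \<Rightarrow> p1" where
  "mobius M (Fin x) =
     (if of_int (M$2$1) * x + of_int (M$2$2) = 0 then Infty
      else Fin ((of_int (M$1$1) * x + of_int (M$1$2)) / (of_int (M$2$1) * x + of_int (M$2$2))))"
| "mobius M Infty = (if M$2$1 = 0 then Infty else Fin (of_int (M$1$1) / of_int (M$2$1)))"

text \<open>
  Elements of the projective group are represented by integer matrices of determinant
  \<open>\<plusminus>1\<close>; they enter only through their action, which does not depend on the sign.
\<close>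

lemma mobius_uminus: "mobius (- M) x = mobius M x"
proof (cases x)
  case (Fin r)
  let ?u = "of_int (M$1$1) * r + of_int (M$1$2)" and ?v = "of_int (M$2$1) * r + of_int (M$2$2)"
  have "mobius (- M) x = (if - ?v = 0 then Infty else Fin (- ?u / - ?v))"
    by (simp add: Fin)
  also have "\<dots> = mobius M x"
    by (simp only: minus_divide_divide neg_equal_0_iff_equal Fin mobius.simps)
  finally show ?thesis .
qed auto

fun proj_letter :: "letter \<Rightarrow> int^2^2" where
  "proj_letter Let_l = mat22 1 0 1 1"
| "proj_letter Let_n = mat22 1 1 0 1"

definition proj_f :: "int^2^2" where "proj_f = mat22 0 1 1 0"

fun proj_word :: "letter list \<Rightarrow> int^2^2" where
  "proj_word [] = mat 1"
| "proj_word (q # w) = proj_letter q ** proj_word w"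

fun proj :: "sg \<Rightarrow> int^2^2" where
  "proj (Sg w e) = proj_word w ** (if e then proj_f else mat 1)"

lemma proj_generators:
  "proj sg_l = mat22 1 0 1 1" "proj sg_n = mat22 1 1 0 1" "proj sg_f = mat22 0 1 1 0"
  by (simp_all add: sg_l_def sg_n_def sg_f_def proj_f_def)

lemma mat22_mult:
  "mat22 a b c d ** mat22 a' b' c' d' =
     mat22 (a * a' + b * c') (a * b' + b * d') (c * a' + d * c') (c * b' + d * d')"
  by (simp add: mat22_def Finite_Cartesian_Product.vec_eq_iff matrix_matrix_mult_def forall_2 sum_2)

lemma mat_1_mat22: "mat 1 = mat22 1 0 0 1"
  by (simp add: mat22_def Finite_Cartesian_Product.vec_eq_iff Finite_Cartesian_Product.mat_def forall_2)

lemma proj_one: "proj 1 = mat 1"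
  by (simp add: one_sg_def)

lemma proj_mult: "proj (a * b) = proj a ** proj b"
proof -
  have app: "proj_word (u @ v) = proj_word u ** proj_word v" for u v
    by (induction u) (auto simp: matrix_mul_assoc)
  have fq: "proj_letter (swap_letter q) ** proj_f = proj_f ** proj_letter q" for q
    by (cases q) (auto simp: proj_f_def mat22_mult)
  have fw: "proj_word (map swap_letter w) ** proj_f = proj_f ** proj_word w" for w
  proof (induction w)
    case (Cons q w)
    have "proj_word (map swap_letter (q # w)) ** proj_f =
        (proj_letter (swap_letter q) ** proj_f) ** proj_word w"
      using Cons by (simp add: matrix_mul_assoc [symmetric])
    then show ?case by (simp add: fq matrix_mul_assoc)
  qed simp
  have ff: "proj_f ** proj_f = mat 1"
    by (simp add: proj_f_def mat22_mult mat_1_mat22)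
  obtain u e v d where ab: "a = Sg u e" "b = Sg v d" by (cases a; cases b) auto
  have 1: "proj_word u ** proj_word (map swap_letter v) ** proj_f =
      proj_word u ** proj_f ** proj_word v"
    by (simp only: matrix_mul_assoc [symmetric] fw)
  have 2: "proj_word u ** proj_f ** proj_word v ** proj_f =
      proj_word u ** proj_word (map swap_letter v)"
  proof -
    have "proj_word u ** proj_f ** proj_word v ** proj_f =
        proj_word u ** proj_word (map swap_letter v) ** proj_f ** proj_f" by (simp only: 1)
    then show ?thesis by (simp only: matrix_mul_assoc [symmetric] ff matrix_mul_rid)
  qed
  show ?thesis
    by (cases e; cases d) (simp_all add: ab app 1 2 matrix_mul_assoc)
qed

text \<open>
  A unimodular interval is given by its matrix \<open>M\<close> with rows \<open>(p', p)\<close>, \<open>(q', q)\<close> and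
  determinant 1; the corresponding set of points, from \<open>p/q\<close> to \<open>p'/q'\<close>, is the image
  of \<open>[0, \<infinity>]\<close>.
\<close>

definition unimodular :: "int^2^2 \<Rightarrow> bool" where
  "unimodular M \<longleftrightarrow> det M = 1"

definition interval :: "int^2^2 \<Rightarrow> p1 set" where
  "interval M = mobius M ` insert Infty (Fin ` {0..})"

definition S0 :: "int^2^2" where "S0 = mat22 0 (-1) 1 0"

definition Bmat :: "(nat \<Rightarrow> int^2^2) \<Rightarrow> edge \<Rightarrow> int^2^2" where
  "Bmat I a = I (src a) ** proj (lab a) ** matrix_inv (I (tgt a))"

definition Dmat :: "(nat \<Rightarrow> int^2^2) \<Rightarrow> edge \<Rightarrow> int^2^2" where
  "Dmat I a = matrix_inv (Bmat I a)"

primrec seq_prod :: "(edge \<Rightarrow> int^2^2) \<Rightarrow> (nat \<Rightarrow> edge) \<Rightarrow> nat \<Rightarrow> int^2^2" where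
  "seq_prod M a 0 = mat 1"
| "seq_prod M a (Suc t) = seq_prod M a t ** M (a t)"


section \<open>Attractors and Gauss-type maps\<close>

definition cf_point :: "(nat \<Rightarrow> int^2^2) \<Rightarrow> (nat \<Rightarrow> edge) \<Rightarrow> p1" where
  "cf_point I a = (THE x. x \<in> (\<Inter>t. mobius (seq_prod (Bmat I) a t) ` interval (I (src (a t)))))"

definition cf_point_dual :: "(nat \<Rightarrow> int^2^2) \<Rightarrow> (nat \<Rightarrow> edge) \<Rightarrow> p1" where
  "cf_point_dual I a =
     (THE x. x \<in> (\<Inter>t. mobius (seq_prod (Dmat I) a t) ` interval (I (tgt (a t)) ** S0)))"

definition H_set :: "edge set \<Rightarrow> (nat \<Rightarrow> int^2^2) \<Rightarrow> nat \<Rightarrow> p1 set" where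
  "H_set A I i = cf_point I ` paths A i"

definition K_set :: "edge set \<Rightarrow> (nat \<Rightarrow> int^2^2) \<Rightarrow> nat \<Rightarrow> p1 set" where
  "K_set A I i = cf_point_dual I ` rev_paths A i"

definition acts :: "edge set \<Rightarrow> (nat \<Rightarrow> int^2^2) \<Rightarrow> edge \<Rightarrow> nat \<times> p1 \<Rightarrow> bool" where
  "acts A I a ix \<longleftrightarrow> (\<exists>s \<in> paths A (fst ix). s 0 = a \<and> cf_point I s = snd ix)"

definition calF :: "edge set \<Rightarrow> (nat \<Rightarrow> int^2^2) \<Rightarrow> nat \<times> p1 \<Rightarrow> (nat \<times> p1) set" where
  "calF A I ix = {(tgt a, mobius (matrix_inv (Bmat I a)) (snd ix)) | a. a \<in> A \<and> acts A I a ix}"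

definition calF_dual :: "edge set \<Rightarrow> (nat \<Rightarrow> int^2^2) \<Rightarrow> nat \<times> p1 \<Rightarrow> (nat \<times> p1) set" where
  "calF_dual A I iy = {(src a, mobius (matrix_inv (Dmat I a)) (snd iy)) | a.
     a \<in> A \<and> tgt a = fst iy \<and> mobius (matrix_inv (Dmat I a)) (snd iy) \<in> K_set A I (src a)}"

definition realization :: "nat \<Rightarrow> edge set \<Rightarrow> (nat \<Rightarrow> int^2^2) \<Rightarrow> bool" where
  "realization n A I \<longleftrightarrow>
     (\<forall>i < n. \<forall>j < n. \<forall>x \<in> H_set A I i \<inter> H_set A I j.
        snd ` calF A I (i, x) = snd ` calF A I (j, x))"

definition geometric :: "nat \<Rightarrow> edge set \<Rightarrow> (nat \<Rightarrow> int^2^2) \<Rightarrow> bool" where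
  "geometric n A I \<longleftrightarrow> realization n A I \<and> realization n (edge_sharp ` A) (\<lambda>i. I i ** S0)"

text \<open>
  The multivalued maps on points.  For a (geometric) realization all sets in these unions
  are equal, so the choice of the node does not matter.
\<close>

definition Fmap :: "nat \<Rightarrow> edge set \<Rightarrow> (nat \<Rightarrow> int^2^2) \<Rightarrow> p1 \<Rightarrow> p1 set" where
  "Fmap n A I x = (\<Union>i \<in> {i. i < n \<and> x \<in> H_set A I i}. snd ` calF A I (i, x))"

definition Fmap_dual :: "nat \<Rightarrow> edge set \<Rightarrow> (nat \<Rightarrow> int^2^2) \<Rightarrow> p1 \<Rightarrow> p1 set" where
  "Fmap_dual n A I y = (\<Union>i \<in> {i. i < n \<and> y \<in> K_set A I i}. snd ` calF_dual A I (i, y))"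


section \<open>Orbits and periods\<close>

definition orbits :: "('a \<Rightarrow> 'a set) \<Rightarrow> 'a \<Rightarrow> (nat \<Rightarrow> 'a) set" where
  "orbits \<Phi> x0 = {x. x 0 = x0 \<and> (\<forall>t. x (Suc t) \<in> \<Phi> (x t))}"

definition purely_periodic :: "(nat \<Rightarrow> 'a) \<Rightarrow> bool" where
  "purely_periodic x \<longleftrightarrow> (\<exists>p \<ge> 1. \<forall>t. x (t + p) = x t)"

definition period :: "(nat \<Rightarrow> 'a) \<Rightarrow> nat" where
  "period x = (LEAST p. p \<ge> 1 \<and> (\<forall>t. x (t + p) = x t))"

definition symbolic_orbits :: "edge set \<Rightarrow> (nat \<Rightarrow> int^2^2) \<Rightarrow> nat \<times> p1 \<Rightarrow> (nat \<Rightarrow> edge) set" where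
  "symbolic_orbits A I ix = {a \<in> paths A (fst ix). cf_point I a = snd ix}"

definition symbolic_orbits_dual :: "edge set \<Rightarrow> (nat \<Rightarrow> int^2^2) \<Rightarrow> nat \<times> p1 \<Rightarrow> (nat \<Rightarrow> edge) set" where
  "symbolic_orbits_dual A I iy = {a \<in> rev_paths A (fst iy). cf_point_dual I a = snd iy}"

definition symbolic_periods :: "(nat \<Rightarrow> edge) set \<Rightarrow> edge list set" where
  "symbolic_periods S = {map a [0..<period a] | a. a \<in> S \<and> purely_periodic a}"


section \<open>Quadratic irrationals\<close>

definition rat_quadratic_root :: "rat poly \<Rightarrow> real \<Rightarrow> bool" where
  "rat_quadratic_root p x \<longleftrightarrow> degree p = 2 \<and> poly (map_poly of_rat p) x = 0"

definition quadratic_irrational :: "real \<Rightarrow> bool" where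
  "quadratic_irrational x \<longleftrightarrow> x \<notin> \<rat> \<and> (\<exists>p. rat_quadratic_root p x)"

text \<open>The other root of the minimal polynomial; meaningful for quadratic irrationals only.\<close>

definition galois_conj :: "real \<Rightarrow> real" where
  "galois_conj x = (THE x'. x' \<noteq> x \<and> (\<exists>p. rat_quadratic_root p x \<and> rat_quadratic_root p x'))"

lemma galois_conj_eq:
  assumes p: "rat_quadratic_root p x" and x: "x \<notin> \<rat>"
  shows "galois_conj x = - of_rat (coeff p 1 / coeff p 2) - x"
proof -
  have ev: "poly (map_poly of_rat q) y =
      of_rat (coeff q 0) + of_rat (coeff q 1) * y + of_rat (coeff q 2) * y\<^sup>2"
    if "degree q = 2" for q :: "rat poly" and y :: real
    using that by (simp add: poly_altdef degree_map_poly coeff_map_poly numeral_2_eq_2)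
  have root: "of_rat (coeff q 1 / coeff q 2) = - x - y"
    if q: "rat_quadratic_root q x" "rat_quadratic_root q y" "y \<noteq> x" for q y
  proof -
    have d: "degree q = 2" using q by (simp add: rat_quadratic_root_def)
    then have nz: "coeff q 2 \<noteq> 0" by (metis leading_coeff_0_iff degree_0 zero_neq_numeral)
    have "(y - x) * (of_rat (coeff q 1) + of_rat (coeff q 2) * (x + y)) = 0"
      using q d ev [OF d] by (simp add: rat_quadratic_root_def power2_eq_square algebra_simps)
    then have "of_rat (coeff q 1) + of_rat (coeff q 2) * (x + y) = 0" using q(3) by simp
    then have "of_rat (coeff q 1) = of_rat (coeff q 2) * (- x - y)" by (simp add: algebra_simps)
    then show ?thesis using nz by (simp add: of_rat_divide)
  qed
  have same: "coeff q 1 / coeff q 2 = coeff p 1 / coeff p 2" if q: "rat_quadratic_root q x" for q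
  proof (rule ccontr)
    assume ne: "coeff q 1 / coeff q 2 \<noteq> coeff p 1 / coeff p 2"
    have mon: "x\<^sup>2 = - of_rat (coeff r 0 / coeff r 2) - of_rat (coeff r 1 / coeff r 2) * x"
      if r: "rat_quadratic_root r x" for r
    proof -
      have d: "degree r = 2" using r by (simp add: rat_quadratic_root_def)
      then have nz: "coeff r 2 \<noteq> 0" by (metis leading_coeff_0_iff degree_0 zero_neq_numeral)
      have "of_rat (coeff r 0) + of_rat (coeff r 1) * x + of_rat (coeff r 2) * x\<^sup>2 = 0"
        using r ev [OF d] by (simp add: rat_quadratic_root_def)
      then show ?thesis using nz by (simp add: of_rat_divide field_simps)
    qed
    define u where "u = coeff q 1 / coeff q 2 - coeff p 1 / coeff p 2"
    define v where "v = coeff p 0 / coeff p 2 - coeff q 0 / coeff q 2"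
    have "of_rat u * x = of_rat v"
      using mon [OF p] mon [OF q] by (simp add: u_def v_def of_rat_diff algebra_simps)
    moreover have "u \<noteq> 0" using ne by (simp add: u_def)
    ultimately have "x = of_rat (v / u)" by (simp add: of_rat_divide field_simps)
    then show False using x by simp
  qed
  let ?x' = "- of_rat (coeff p 1 / coeff p 2) - x"
  have d: "degree p = 2" using p by (simp add: rat_quadratic_root_def)
  then have nz: "coeff p 2 \<noteq> 0" by (metis leading_coeff_0_iff degree_0 zero_neq_numeral)
  have ne: "?x' \<noteq> x"
  proof
    assume "?x' = x"
    moreover have "x = of_rat (- s / 2)" if "- of_rat s - x = x" for s
      using that by (simp add: of_rat_divide of_rat_minus)
    ultimately have "x = of_rat (- (coeff p 1 / coeff p 2) / 2)" by blast
    then show False using x by (metis Rats_of_rat)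
  qed
  have "of_rat (coeff p 1) = of_rat (coeff p 2) * (- x - ?x')"
    using nz by (simp add: of_rat_divide)
  then have "poly (map_poly of_rat p) ?x' = poly (map_poly of_rat p) x"
  proof -
    have "c0 + c1 * y + c2 * y\<^sup>2 = c0 + c1 * x + c2 * x\<^sup>2" if "c1 = c2 * (- x - y)"
      for c0 c1 c2 y :: real
      by (simp add: that power2_eq_square algebra_simps)
    from this [OF \<open>of_rat (coeff p 1) = _\<close>] show ?thesis unfolding ev [OF d] .
  qed
  then have "rat_quadratic_root p ?x'" using p by (simp add: rat_quadratic_root_def)
  show ?thesis unfolding galois_conj_def
  proof (rule the_equality)
    show "?x' \<noteq> x \<and> (\<exists>p. rat_quadratic_root p x \<and> rat_quadratic_root p ?x')"
      using ne p \<open>rat_quadratic_root p ?x'\<close> by blast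
  next
    fix y
    assume "y \<noteq> x \<and> (\<exists>q. rat_quadratic_root q x \<and> rat_quadratic_root q y)"
    then obtain q where q: "rat_quadratic_root q x" "rat_quadratic_root q y" "y \<noteq> x" by blast
    show "y = ?x'" using root [OF q] same [OF q(1)] by simp
  qed
qed

fun p1_conj :: "p1 \<Rightarrow> p1" where
  "p1_conj (Fin x) = Fin (galois_conj x)"
| "p1_conj Infty = Infty"

end

theory Submission
  imports Defs
begin

text \<open>
  The theorem is an analogue of Galois's theorem on purely periodic continued fractions.  Applying
  the inverse of \<open>I i\<close> to an irrational point \<open>x\<close> of \<open>H_set A I i\<close> gives a point between 0
  and \<open>\<infinity>\<close>, and such a point determines an infinite word in l and n, its expansion with respect to
  mediants (\<open>cylinder_word_unique\<close>).  The paths from \<open>i\<close> with point \<open>x\<close> are the factorizations of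
  this word by elements of the code.

  The main tool is that a periodic factorization is the only one (\<open>periodic_expansion_unique\<close>).
  The code property speaks about finite products, but any factorization of a periodic word is at
  two times at the same node and at the same place of the period, and its part up to the later time
  has the same product as some periods of the periodic factorization followed by its part up to the
  earlier time.  As a consequence, a path that
  returns to its initial node and to its initial point is periodic (\<open>recurrence_forces_period\<close>).

  In a realization an \<open>F\<close>-orbit lifts to a path from any node that its initial point belongs to
  (\<open>orbit_lift\<close>), and a purely periodic orbit lifts to a periodic path from a suitable node
  (\<open>periodic_orbit_lift\<close>).  Hence a point with a purely periodic orbit has no other orbit.  The
  matrix of a loop fixes the point of the loop, an irrational number, which is therefore quadratic;
  it also fixes the point of the reversed loop, which lies in the complementary interval and so is
  the Galois conjugate (\<open>reversed_loop_conjugate\<close>).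

  Conversely, suppose that \<open>\<omega>\<close> belongs to \<open>H_set A I i\<close> and its conjugate to \<open>K_set A I i\<close>.  The
  two expansions together form a path that is infinite in both directions.  Going backwards along
  it one meets conjugate pairs that are separated by the interval of the current node and have the
  discriminant of \<open>\<omega>\<close>, and these are finitely many; so some pair recurs at the same node,
  and periodicity follows (\<open>reduced_point_periodic\<close>).

  The dual continued fraction is the continued fraction of the code \<open>edge_sharp ` A\<close> with the
  intervals \<open>I i ** S0\<close>: its maps and attractors coincide with \<open>Dmat\<close> and \<open>K_set\<close>, so that the
  statements about paths and orbits apply to it as well (\<open>dual_system\<close>, \<open>Fmap_dual_eq\<close>).
\<close>

section \<open>The action on the projective line\<close>

text \<open>The point with homogeneous coordinates \<open>u\<close> and \<open>v\<close>.\<close>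

definition pt :: "real \<Rightarrow> real \<Rightarrow> p1" where
  "pt u v = (if v = 0 then Infty else Fin (u / v))"

definition nonneg :: "p1 set" where
  "nonneg = insert Infty (Fin ` {0..})"

text \<open>The generator f has determinant \<open>-1\<close>, hence the two signs.\<close>

definition gl2 :: "int^2^2 \<Rightarrow> bool" where
  "gl2 M \<longleftrightarrow> det M = 1 \<or> det M = -1"

text \<open>
  The rational points, including \<open>\<infinity>\<close>.  In terms of integral homogeneous coordinates
  it is plain that integer matrices preserve them.
\<close>

definition ratpt :: "p1 \<Rightarrow> bool" where
  "ratpt x \<longleftrightarrow> (\<exists>m k :: int. (m \<noteq> 0 \<or> k \<noteq> 0) \<and> x = pt (of_int m) (of_int k))"

lemma mat22_nth [simp]:
  "mat22 a b c d $ 1 $ 1 = a" "mat22 a b c d $ 1 $ 2 = b"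
  "mat22 a b c d $ 2 $ 1 = c" "mat22 a b c d $ 2 $ 2 = d"
  by (simp_all add: mat22_def)

lemma mat22_eta: "mat22 (M$1$1) (M$1$2) (M$2$1) (M$2$2) = M"
  by (simp add: Finite_Cartesian_Product.vec_eq_iff forall_2)

lemma mat22_cases: obtains a b c d where "M = mat22 a b c d"
  by (metis mat22_eta)

lemma det_mat22 [simp]: "det (mat22 a b c d) = a * d - b * c"
  by (simp add: det_2)

lemma gl2_mult: "gl2 M \<Longrightarrow> gl2 N \<Longrightarrow> gl2 (M ** N)"
  by (auto simp: gl2_def det_mul)

lemma gl2_one: "gl2 (mat 1)"
  by (simp add: gl2_def)

lemma gl2_unimodular: "unimodular M \<Longrightarrow> gl2 M"
  by (simp add: unimodular_def gl2_def)

lemma gl2_S0: "gl2 S0"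
  by (simp add: gl2_def S0_def)

lemma gl2_inverse_exists:
  assumes "gl2 M"
  shows "\<exists>N. M ** N = mat 1 \<and> N ** M = mat 1"
proof -
  obtain a b c d where M: "M = mat22 a b c d" by (rule mat22_cases)
  from assms consider "a * d - b * c = 1" | "b * c - a * d = 1" by (auto simp: gl2_def M)
  then show ?thesis
  proof cases
    case 1
    then have "M ** mat22 d (- b) (- c) a = mat 1" "mat22 d (- b) (- c) a ** M = mat 1"
      unfolding M mat22_mult mat_1_mat22 by (simp_all add: mult.commute)
    then show ?thesis by blast
  next
    case 2
    then have "M ** mat22 (- d) b c (- a) = mat 1" "mat22 (- d) b c (- a) ** M = mat 1"
      unfolding M mat22_mult mat_1_mat22 by (simp_all add: mult.commute)
    then show ?thesis by blast
  qed
qed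

lemma matrix_inv_gl2:
  assumes "gl2 M"
  shows "M ** matrix_inv M = mat 1" "matrix_inv M ** M = mat 1"
  unfolding atomize_conj matrix_inv_def using someI_ex [OF gl2_inverse_exists [OF assms]] .

lemma gl2_matrix_inv: "gl2 M \<Longrightarrow> gl2 (matrix_inv M)"
  using matrix_inv_gl2 [of M] det_mul [of M "matrix_inv M"]
  by (auto simp: gl2_def zmult_eq_1_iff)

lemma pt_eq_iff:
  assumes "u \<noteq> 0 \<or> v \<noteq> 0" "u' \<noteq> 0 \<or> v' \<noteq> 0"
  shows "pt u v = pt u' v' \<longleftrightarrow> u * v' = u' * v"
  using assms by (auto simp: pt_def field_simps)

lemma p1_pt: obtains u v where "x = pt u v" "u \<noteq> 0 \<or> v \<noteq> 0"
proof (cases x)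
  case (Fin r)
  then show ?thesis using that [of r 1] by (simp add: pt_def)
next
  case Infty
  then show ?thesis using that [of 1 0] by (simp add: pt_def)
qed

lemma mobius_pt:
  assumes "u \<noteq> 0 \<or> v \<noteq> 0"
  shows "mobius M (pt u v) =
    pt (of_int (M$1$1) * u + of_int (M$1$2) * v) (of_int (M$2$1) * u + of_int (M$2$2) * v)"
proof (cases "v = 0")
  case True
  then show ?thesis using assms by (simp add: pt_def)
next
  case False
  have "of_int (M$2$1) * (u / v) + of_int (M$2$2) = (of_int (M$2$1) * u + of_int (M$2$2) * v) / v"
       "of_int (M$1$1) * (u / v) + of_int (M$1$2) = (of_int (M$1$1) * u + of_int (M$1$2) * v) / v"
    using False by (simp_all add: field_simps)
  then show ?thesis using False by (simp add: pt_def)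
qed

lemma mobius_mat22_pt:
  "u \<noteq> 0 \<or> v \<noteq> 0 \<Longrightarrow> mobius (mat22 a b c d) (pt u v) =
    pt (of_int a * u + of_int b * v) (of_int c * u + of_int d * v)"
  using mobius_pt [of u v "mat22 a b c d"] by simp

text \<open>An invertible matrix sends no vector but 0 to 0, so vectors may be used as coordinates.\<close>

lemma gl2_nonzero:
  fixes u v :: real
  assumes "gl2 (mat22 a b c d)" "u \<noteq> 0 \<or> v \<noteq> 0"
  shows "of_int a * u + of_int b * v \<noteq> 0 \<or> of_int c * u + of_int d * v \<noteq> 0"
proof (rule ccontr)
  assume "\<not> ?thesis"
  then have z: "of_int a * u + of_int b * v = 0" "of_int c * u + of_int d * v = 0" by auto
  have "of_int (a * d - b * c) * u = of_int d * (of_int a * u + of_int b * v) - of_int b * (of_int c * u + of_int d * v)"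
       "of_int (a * d - b * c) * v = of_int a * (of_int c * u + of_int d * v) - of_int c * (of_int a * u + of_int b * v)"
    by (simp_all add: algebra_simps)
  then have "of_int (a * d - b * c) * u = 0" "of_int (a * d - b * c) * v = 0" by (simp_all only: z mult_zero_right diff_self)
  moreover have "real_of_int (a * d - b * c) \<noteq> 0"
    using assms(1) unfolding gl2_def det_mat22 of_int_eq_0_iff by linarith
  ultimately show False using assms(2) by simp
qed

lemma mobius_mult:
  assumes "gl2 N"
  shows "mobius (M ** N) x = mobius M (mobius N x)"
proof -
  obtain a b c d where M: "M = mat22 a b c d" by (rule mat22_cases)
  obtain a' b' c' d' where N: "N = mat22 a' b' c' d'" by (rule mat22_cases)
  obtain u v where x: "x = pt u v" and uv: "u \<noteq> 0 \<or> v \<noteq> 0" by (rule p1_pt)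
  show ?thesis
    using gl2_nonzero [OF assms [unfolded N] uv] uv
    by (simp add: M N x mat22_mult mobius_mat22_pt algebra_simps)
qed

lemma mobius_one [simp]: "mobius (mat 1) x = x"
  by (cases x) (simp_all add: mat_1_mat22)

declare mobius.simps [simp del]

lemma mobius_inv_left [simp]: "gl2 M \<Longrightarrow> mobius (matrix_inv M) (mobius M x) = x"
  by (simp flip: mobius_mult add: matrix_inv_gl2)

lemma mobius_inv_right [simp]: "gl2 M \<Longrightarrow> mobius M (mobius (matrix_inv M) x) = x"
  by (simp flip: mobius_mult add: matrix_inv_gl2 gl2_matrix_inv)

lemma inj_mobius: "gl2 M \<Longrightarrow> inj (mobius M)"
  by (metis injI mobius_inv_left)

lemma mobius_image_mult:
  "gl2 N \<Longrightarrow> mobius (M ** N) ` S = mobius M ` mobius N ` S"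
  by (simp add: image_image mobius_mult)

lemma ratpt_Fin: "ratpt (Fin r) \<longleftrightarrow> r \<in> \<rat>"
proof
  assume "ratpt (Fin r)"
  then show "r \<in> \<rat>" by (auto simp: ratpt_def pt_def split: if_splits)
next
  assume "r \<in> \<rat>"
  then obtain m k :: int where "r = of_int m / of_int k" "k \<noteq> 0"
    by (metis Rats_cases' of_int_0_less_iff less_irrefl)
  then show "ratpt (Fin r)" unfolding ratpt_def pt_def by force
qed

lemma ratpt_Infty: "ratpt Infty"
  unfolding ratpt_def pt_def by (rule exI [of _ 1], rule exI [of _ 0]) simp

lemma not_ratptE: assumes "\<not> ratpt x" obtains r where "x = Fin r" "r \<notin> \<rat>"
  using assms by (cases x) (auto simp: ratpt_Fin ratpt_Infty)

lemma ratpt_mobius_imp: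
  assumes "gl2 M" "ratpt x"
  shows "ratpt (mobius M x)"
proof -
  obtain a b c d where M: "M = mat22 a b c d" by (rule mat22_cases)
  obtain m k :: int where mk: "m \<noteq> 0 \<or> k \<noteq> 0" "x = pt (of_int m) (of_int k)"
    using assms by (auto simp: ratpt_def)
  have nz: "real_of_int (a * m + b * k) \<noteq> 0 \<or> real_of_int (c * m + d * k) \<noteq> 0"
    using gl2_nonzero [OF assms(1) [unfolded M], of "of_int m" "of_int k"] mk by simp
  have "mobius M x = pt (of_int (a * m + b * k)) (of_int (c * m + d * k))"
    using mk by (simp add: M mobius_mat22_pt)
  then show ?thesis using nz unfolding ratpt_def of_int_eq_0_iff by blast
qed

lemma ratpt_mobius [simp]: "gl2 M \<Longrightarrow> ratpt (mobius M x) \<longleftrightarrow> ratpt x"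
  by (metis ratpt_mobius_imp gl2_matrix_inv mobius_inv_left)

section \<open>Words contract the projective line\<close>

text \<open>
  The coordinate \<open>u / (u + v)\<close> identifies the interval from 0 to \<open>\<infinity>\<close> with the bounded
  interval from 0 to 1, so that lengths of its subintervals make sense.
\<close>

fun coord :: "p1 \<Rightarrow> real" where
  "coord Infty = 1"
| "coord (Fin r) = r / (1 + r)"

lemma nonneg_pt: "u \<ge> 0 \<Longrightarrow> v \<ge> 0 \<Longrightarrow> pt u v \<in> nonneg"
  by (auto simp: pt_def nonneg_def)

lemma nonnegE:
  assumes "x \<in> nonneg"
  obtains u v where "x = pt u v" "u \<ge> 0" "v \<ge> 0" "u + v > 0"
proof (cases x)
  case (Fin r)
  then show ?thesis using that [of r 1] assms by (auto simp: pt_def nonneg_def)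
next
  case Infty
  then show ?thesis using that [of 1 0] by (simp add: pt_def)
qed

lemma coord_pt: "u \<ge> 0 \<Longrightarrow> v \<ge> 0 \<Longrightarrow> u + v > 0 \<Longrightarrow> coord (pt u v) = u / (u + v)"
proof (cases "v = 0")
  case False
  assume "u \<ge> 0" "v \<ge> 0"
  then have "1 + u / v = (u + v) / v" "v > 0" using False by (simp_all add: field_simps)
  then show ?thesis using False by (simp add: pt_def)
qed (simp add: pt_def)

lemma coord_inj: assumes "x \<in> nonneg" "y \<in> nonneg" "coord x = coord y" shows "x = y"
proof -
  obtain u v where x: "x = pt u v" "u \<ge> 0" "v \<ge> 0" "u + v > 0" using assms(1) by (rule nonnegE)
  obtain u' v' where y: "y = pt u' v'" "u' \<ge> 0" "v' \<ge> 0" "u' + v' > 0" using assms(2) by (rule nonnegE)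
  have "u / (u + v) = u' / (u' + v')" using assms(3) x y by (simp add: coord_pt)
  then have "u * v' = u' * v" using x y by (simp add: field_simps)
  moreover have "u \<noteq> 0 \<or> v \<noteq> 0" "u' \<noteq> 0 \<or> v' \<noteq> 0" using x y by auto
  ultimately show ?thesis using x y pt_eq_iff by blast
qed

text \<open>The irrational points of \<open>cylinder w\<close> are those whose infinite word begins with \<open>w\<close>.\<close>

definition cylinder :: "letter list \<Rightarrow> p1 set" where
  "cylinder w = mobius (proj_word w) ` nonneg"

lemma proj_word_append: "proj_word (u @ v) = proj_word u ** proj_word v"
  by (induction u) (auto simp: matrix_mul_assoc)

text \<open>
  Appending a letter adds one column of the matrix to the other, so the product of the two
  column sums grows by the square of one of them, hence by at least 1.
\<close>

lemma proj_word_growth: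
  "\<exists>a b c d. proj_word w = mat22 a b c d \<and> a \<ge> 0 \<and> b \<ge> 0 \<and> c \<ge> 0 \<and> d \<ge> 0 \<and>
     a * d - b * c = 1 \<and> (a + c) * (b + d) \<ge> 1 + int (length w)"
proof (induction w rule: rev_induct)
  case Nil
  show ?case by (rule exI [of _ 1], rule exI [of _ 0], rule exI [of _ 0], rule exI [of _ 1])
      (simp add: mat_1_mat22)
next
  case (snoc q w)
  then obtain a b c d where M: "proj_word w = mat22 a b c d" "a \<ge> 0" "b \<ge> 0" "c \<ge> 0" "d \<ge> 0"
    "a * d - b * c = 1" "(a + c) * (b + d) \<ge> 1 + int (length w)" by blast
  have pos: "a + c \<ge> 1" "b + d \<ge> 1"
  proof -
    have "(a + c) * (b + d) > 0" using M(7) by linarith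
    then show "a + c \<ge> 1" "b + d \<ge> 1" using M by (simp_all add: zero_less_mult_iff)
  qed
  then have sq: "(a + c) * (a + c) \<ge> 1" "(b + d) * (b + d) \<ge> 1"
    using mult_mono [of 1 "a + c" 1 "a + c"] mult_mono [of 1 "b + d" 1 "b + d"] by simp_all
  show ?case
  proof (cases q)
    case Let_l
    have "proj_word (w @ [q]) = mat22 (a + b) b (c + d) d"
      by (simp add: proj_word_append Let_l M mat22_mult)
    moreover have "((a + b) + (c + d)) * (b + d) = (a + c) * (b + d) + (b + d) * (b + d)"
      by (simp add: algebra_simps)
    moreover have "(a + b) * d - b * (c + d) = 1" using M by (simp add: algebra_simps)
    ultimately show ?thesis using M sq
      by (intro exI [of _ "a + b"] exI [of _ b] exI [of _ "c + d"] exI [of _ d]) simp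
  next
    case Let_n
    have "proj_word (w @ [q]) = mat22 a (a + b) c (c + d)"
      by (simp add: proj_word_append Let_n M mat22_mult)
    moreover have "(a + c) * ((a + b) + (c + d)) = (a + c) * (b + d) + (a + c) * (a + c)"
      by (simp add: algebra_simps)
    moreover have "a * (c + d) - (a + b) * c = 1" using M by (simp add: algebra_simps)
    ultimately show ?thesis using M sq
      by (intro exI [of _ a] exI [of _ "a + b"] exI [of _ c] exI [of _ "c + d"]) simp
  qed
qed

lemma gl2_proj_word: "gl2 (proj_word w)"
  using proj_word_growth [of w] by (auto simp: gl2_def)

lemma cylinder_subset_nonneg: "cylinder w \<subseteq> nonneg"
proof
  fix x assume "x \<in> cylinder w"
  then obtain y where y: "y \<in> nonneg" "x = mobius (proj_word w) y" by (auto simp: cylinder_def)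
  obtain u v where uv: "y = pt u v" "u \<ge> 0" "v \<ge> 0" "u + v > 0" using y(1) by (rule nonnegE)
  obtain a b c d where M: "proj_word w = mat22 a b c d" "a \<ge> 0" "b \<ge> 0" "c \<ge> 0" "d \<ge> 0"
    using proj_word_growth by blast
  have "x = pt (of_int a * u + of_int b * v) (of_int c * u + of_int d * v)"
    using uv by (auto simp: y M mobius_mat22_pt)
  then show "x \<in> nonneg" using M uv by (simp add: nonneg_pt)
qed

lemma cylinder_append: "cylinder (u @ v) = mobius (proj_word u) ` cylinder v"
  by (simp add: cylinder_def proj_word_append mobius_image_mult gl2_proj_word)

lemma cylinder_antimono: "cylinder (u @ v) \<subseteq> cylinder u"
  using cylinder_subset_nonneg [of v] by (auto simp: cylinder_append cylinder_def [of u])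

text \<open>
  The determinant being 1, two points with coordinates \<open>(u, v)\<close> and \<open>(u', v')\<close> before the action of the
  matrix differ afterwards by \<open>u v' - v u'\<close> divided by the product of two denominators, and that product
  is at least \<open>u v' + v u'\<close> times the product of the column sums.
\<close>

lemma cylinder_width:
  assumes "x \<in> cylinder w" "y \<in> cylinder w"
  shows "\<bar>coord x - coord y\<bar> \<le> 1 / (1 + real (length w))"
proof -
  obtain a b c d where M: "proj_word w = mat22 a b c d" "a \<ge> 0" "b \<ge> 0" "c \<ge> 0" "d \<ge> 0"
    "a * d - b * c = 1" "(a + c) * (b + d) \<ge> 1 + int (length w)"
    using proj_word_growth by blast
  define s s' where "s = real_of_int (a + c)" and "s' = real_of_int (b + d)"
  have dr: "real_of_int a * of_int d - of_int b * of_int c = 1"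
    by (metis M(6) of_int_1 of_int_diff of_int_mult)
  have ss: "s * s' \<ge> 1 + real (length w)"
    unfolding s_def s'_def using of_int_le_iff [where 'a = real, THEN iffD2, OF M(7)] by simp
  then have "s * s' > 0" by linarith
  moreover have "s \<ge> 0" "s' \<ge> 0" using M by (simp_all add: s_def s'_def)
  ultimately have pos: "s > 0" "s' > 0" by (auto simp: zero_less_mult_iff)
  have *: "\<exists>u v. u \<ge> 0 \<and> v \<ge> 0 \<and> s * u + s' * v > 0 \<and>
      coord z = (of_int a * u + of_int b * v) / (s * u + s' * v)" if "z \<in> cylinder w" for z
  proof -
    obtain y where y: "y \<in> nonneg" "z = mobius (proj_word w) y"
      using \<open>z \<in> cylinder w\<close> by (auto simp: cylinder_def)
    obtain u v where uv: "y = pt u v" "u \<ge> 0" "v \<ge> 0" "u + v > 0" using y(1) by (rule nonnegE)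
    have z: "z = pt (of_int a * u + of_int b * v) (of_int c * u + of_int d * v)"
      using uv by (auto simp: y M mobius_mat22_pt)
    have p: "s * u + s' * v > 0"
      using uv pos by (metis add_cancel_right_left add_nonneg_pos add_pos_nonneg less_eq_real_def mult_nonneg_nonneg mult_pos_pos)
    have "of_int a * u + of_int b * v + (of_int c * u + of_int d * v) = s * u + s' * v"
      by (simp add: s_def s'_def algebra_simps)
    then show ?thesis using uv p M z coord_pt [of "of_int a * u + of_int b * v" "of_int c * u + of_int d * v"]
      by auto
  qed
  obtain u v where x: "u \<ge> 0" "v \<ge> 0" "s * u + s' * v > 0"
      "coord x = (of_int a * u + of_int b * v) / (s * u + s' * v)" using * assms by blast
  obtain u' v' where y: "u' \<ge> 0" "v' \<ge> 0" "s * u' + s' * v' > 0"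
      "coord y = (of_int a * u' + of_int b * v') / (s * u' + s' * v')" using * assms by blast
  let ?N = "(s * u + s' * v) * (s * u' + s' * v')"
  have N: "?N > 0" using x y by simp
  have "coord x - coord y = ((of_int a * u + of_int b * v) * (s * u' + s' * v') -
      (of_int a * u' + of_int b * v') * (s * u + s' * v)) / ?N"
    unfolding x(4) y(4) using x(3) y(3) by (simp add: diff_frac_eq)
  also have "(of_int a * u + of_int b * v) * (s * u' + s' * v') -
      (of_int a * u' + of_int b * v') * (s * u + s' * v) =
      (of_int a * of_int d - of_int b * of_int c) * (u * v' - v * u')"
    by (simp add: s_def s'_def algebra_simps)
  finally have "\<bar>coord x - coord y\<bar> = \<bar>u * v' - v * u'\<bar> / ?N"
    using N by (simp add: dr abs_divide)
  also have "\<dots> \<le> (u * v' + v * u') / ?N"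
  proof -
    have "u * v' \<ge> 0" "v * u' \<ge> 0" using x y by simp_all
    then show ?thesis using N by (intro divide_right_mono) linarith+
  qed
  also have "\<dots> \<le> 1 / (s * s')"
  proof -
    have "?N = s * s' * (u * v' + v * u') + (s * s * (u * u') + s' * s' * (v * v'))"
      by (simp add: algebra_simps)
    moreover have "s * s * (u * u') + s' * s' * (v * v') \<ge> 0" using x y by simp
    ultimately show ?thesis using N pos by (simp add: field_simps)
  qed
  also have "\<dots> \<le> 1 / (1 + real (length w))" using ss by (intro divide_left_mono) auto
  finally show ?thesis .
qed

text \<open>
  A cylinder is the interval between the images of 0 and \<open>\<infinity>\<close>: the two inequalities say that the
  coordinates of the preimage are not negative.
\<close>

lemma cylinder_iff:
  "x \<in> cylinder w \<longleftrightarrow> x \<in> nonneg \<and> coord (mobius (proj_word w) (Fin 0)) \<le> coord x \<and>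
    coord x \<le> coord (mobius (proj_word w) Infty)"
proof (cases "x \<in> nonneg")
  case True
  obtain a b c d where M: "proj_word w = mat22 a b c d" "a \<ge> 0" "b \<ge> 0" "c \<ge> 0" "d \<ge> 0"
    "a * d - b * c = 1" "(a + c) * (b + d) \<ge> 1 + int (length w)"
    using proj_word_growth by blast
  have dr: "real_of_int a * of_int d - of_int b * of_int c = 1"
    by (metis M(6) of_int_1 of_int_diff of_int_mult)
  have pos: "real_of_int a + of_int c > 0" "real_of_int b + of_int d > 0"
  proof -
    have "(a + c) * (b + d) > 0" using M(7) by linarith
    then have "a + c > 0" "b + d > 0" using M by (simp_all add: zero_less_mult_iff)
    then show "real_of_int a + of_int c > 0" "real_of_int b + of_int d > 0" by linarith+
  qed
  obtain u v where uv: "x = pt u v" "u \<ge> 0" "v \<ge> 0" "u + v > 0" using True by (rule nonnegE)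
  \<comment> \<open>the coordinates of the preimage of \<open>x\<close>\<close>
  define r s where "r = of_int d * u - of_int b * v" and "s = of_int a * v - of_int c * u"
  have "of_int a * r + of_int b * s = (of_int a * of_int d - of_int b * of_int c) * u"
       "of_int c * r + of_int d * s = (of_int a * of_int d - of_int b * of_int c) * v"
    by (simp_all add: r_def s_def algebra_simps)
  then have eqs: "of_int a * r + of_int b * s = u" "of_int c * r + of_int d * s = v"
    by (simp_all add: dr)
  then have rs: "r \<noteq> 0 \<or> s \<noteq> 0" using uv(4) by (metis add.right_neutral less_irrefl mult_zero_right)
  have x: "x = mobius (proj_word w) (pt r s)" using rs by (simp add: M(1) mobius_mat22_pt eqs uv(1))
  have "x \<in> cylinder w \<longleftrightarrow> pt r s \<in> nonneg"
    unfolding cylinder_def x using inj_image_mem_iff [OF inj_mobius [OF gl2_proj_word]] by blast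
  also have "\<dots> \<longleftrightarrow> r \<ge> 0 \<and> s \<ge> 0"
  proof
    assume "pt r s \<in> nonneg"
    then obtain p q where pq: "pt r s = pt p q" "p \<ge> 0" "q \<ge> 0" "p + q > 0" by (rule nonnegE)
    have "p \<noteq> 0 \<or> q \<noteq> 0" using pq by auto
    then have "r * q = p * s" using pq(1) rs pt_eq_iff by blast
    \<comment> \<open>so \<open>(r, s)\<close> is a multiple of \<open>(p, q)\<close>, and the factor is positive because \<open>u + v\<close> is\<close>
    then have e: "r * (p + q) = p * (r + s)" "s * (p + q) = q * (r + s)" by (simp_all add: algebra_simps)
    have "(u + v) * (p + q) = (of_int a + of_int c) * (r * (p + q)) + (of_int b + of_int d) * (s * (p + q))"
      by (simp add: eqs [symmetric] algebra_simps)
    also have "\<dots> = ((of_int a + of_int c) * p + (of_int b + of_int d) * q) * (r + s)"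
      unfolding e by (simp add: algebra_simps)
    finally have "((of_int a + of_int c) * p + (of_int b + of_int d) * q) * (r + s) > 0"
      using uv(4) pq(4) by (metis mult_pos_pos)
    moreover have "(of_int a + of_int c) * p + (of_int b + of_int d) * q \<ge> 0"
      using pq pos by simp
    ultimately have "r + s > 0" by (simp add: zero_less_mult_iff)
    then have "r * (p + q) \<ge> 0" "s * (p + q) \<ge> 0" unfolding e using pq by simp_all
    then show "r \<ge> 0 \<and> s \<ge> 0" using pq(4) by (simp add: zero_le_mult_iff)
  qed (simp add: nonneg_pt)
  also have "\<dots> \<longleftrightarrow> of_int b / (of_int b + of_int d) \<le> u / (u + v) \<and> u / (u + v) \<le> of_int a / (of_int a + of_int c)"
    using pos uv by (simp add: r_def s_def divide_le_eq le_divide_eq field_simps)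
  also have "of_int b / (of_int b + of_int d) = coord (mobius (proj_word w) (Fin 0))"
    using mobius_mat22_pt [of 0 1 a b c d] M pos by (simp add: pt_def [of 0 1] coord_pt)
  also have "of_int a / (of_int a + of_int c) = coord (mobius (proj_word w) Infty)"
    using mobius_mat22_pt [of 1 0 a b c d] M pos by (simp add: pt_def [of 1 0] coord_pt)
  also have "u / (u + v) = coord x" using uv by (simp add: coord_pt)
  finally show ?thesis using True by simp
qed (use cylinder_subset_nonneg in blast)

text \<open>
  The endpoints are monotone and all cylinders contain the supremum of the lower ones; there is
  no second common point because the widths tend to 0.
\<close>

lemma nested_cylinders_point:
  fixes w :: "nat \<Rightarrow> letter list"
  assumes step: "\<And>t. \<exists>v. w (Suc t) = w t @ v"
    and unbounded: "\<And>N. \<exists>t. length (w t) \<ge> N"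
  shows "\<exists>!x. \<forall>t. x \<in> cylinder (w t)"
proof -
  define f where "f t = coord (mobius (proj_word (w t)) (Fin 0))" for t
  define g where "g t = coord (mobius (proj_word (w t)) Infty)" for t
  have sub: "cylinder (w t) \<subseteq> cylinder (w s)" if "s \<le> t" for s t
    using that
  proof (induction t rule: dec_induct)
    case (step t)
    then show ?case using assms(1) [of t] cylinder_antimono by fastforce
  qed simp
  have inside: "mobius (proj_word (w t)) (Fin 0) \<in> cylinder (w t)"
    "mobius (proj_word (w t)) Infty \<in> cylinder (w t)" for t
    unfolding cylinder_def nonneg_def by (intro imageI, simp)+
  have nest: "f s \<le> f t" "g t \<le> g s" if "s \<le> t" for s t
    using subsetD [OF sub [OF that]] inside [of t] cylinder_iff [of _ "w s"] unfolding f_def g_def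
    by blast+
  have fg: "f t \<le> g t" for t
    using inside(1) [of t] cylinder_iff [of _ "w t"] unfolding f_def g_def by blast
  have fg0: "f s \<le> g t" for s t
    using nest [of s "max s t"] nest [of t "max s t"] fg [of "max s t"] by simp
  define l where "l = (SUP t. f t)"
  have bdd: "bdd_above (range f)" using fg0 by (auto simp: bdd_above_def)
  have fl: "f t \<le> l" for t unfolding l_def using bdd by (intro cSUP_upper) auto
  have lg: "l \<le> g t" for t unfolding l_def using fg0 by (intro cSUP_least) auto
  have range: "0 \<le> coord x \<and> coord x \<le> 1" if "x \<in> nonneg" for x
  proof -
    obtain u v where uv: "x = pt u v" "u \<ge> 0" "v \<ge> 0" "u + v > 0" using \<open>x \<in> nonneg\<close> by (rule nonnegE)
    then show ?thesis by (simp add: coord_pt)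
  qed
  have l01: "0 \<le> l" "l \<le> 1"
    using range inside [of 0] cylinder_subset_nonneg [of "w 0"] fl [of 0] lg [of 0]
    by (fastforce simp: f_def g_def)+
  define x where "x = pt l (1 - l)"
  have x: "x \<in> nonneg" "coord x = l" using l01 by (simp_all add: x_def nonneg_pt coord_pt)
  have "\<forall>t. x \<in> cylinder (w t)"
    using x(1) fl lg by (simp add: cylinder_iff x(2) f_def g_def)
  moreover have "y = z" if y: "\<forall>t. y \<in> cylinder (w t)" and z: "\<forall>t. z \<in> cylinder (w t)" for y z
  proof (rule coord_inj)
    show "y \<in> nonneg" "z \<in> nonneg" using y z cylinder_subset_nonneg by blast+
    show "coord y = coord z"
    proof (rule ccontr)
      assume "coord y \<noteq> coord z"
      then obtain N :: nat where N: "N > 0" "1 / real N < \<bar>coord y - coord z\<bar>"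
        using real_arch_inverse [of "\<bar>coord y - coord z\<bar>"] by (auto simp: inverse_eq_divide)
      obtain t where "length (w t) \<ge> N" using unbounded by blast
      then have "1 / (1 + real (length (w t))) \<le> 1 / real N"
        using N by (intro divide_left_mono) (auto intro: mult_pos_pos)
      then show False using cylinder_width [of y "w t" z] y z N by fastforce
    qed
  qed
  ultimately show ?thesis by blast
qed

text \<open>The cylinders of l and n, from 0 to 1 and from 1 to \<open>\<infinity>\<close>, have only the point 1 in common.\<close>

lemma cylinder_Cons_letter:
  assumes "\<not> ratpt x" "x \<in> cylinder (q # w)" "x \<in> cylinder (q' # w')"
  shows "q = q'"
proof -
  have *: False if l: "x \<in> cylinder (Let_l # v)" and n: "x \<in> cylinder (Let_n # v')" for v v'
  proof -
    obtain y where y: "y \<in> nonneg" "x = mobius (mat22 1 0 1 1) y"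
      using l cylinder_subset_nonneg cylinder_append [of "[Let_l]" v] by auto
    obtain y' where y': "y' \<in> nonneg" "x = mobius (mat22 1 1 0 1) y'"
      using n cylinder_subset_nonneg cylinder_append [of "[Let_n]" v'] by auto
    obtain u v where uv: "y = pt u v" "u \<ge> 0" "v \<ge> 0" "u + v > 0" using y(1) by (rule nonnegE)
    obtain u' v' where uv': "y' = pt u' v'" "u' \<ge> 0" "v' \<ge> 0" "u' + v' > 0" using y'(1) by (rule nonnegE)
    have x: "x = pt u (u + v)" using uv by (simp add: y mobius_mat22_pt)
    have x': "x = pt (u' + v') v'" using uv' by (simp add: y' mobius_mat22_pt)
    have "pt u (u + v) = pt (u' + v') v'" using x x' by simp
    then have "u * v' = (u' + v') * (u + v)"
      using uv uv' by (subst (asm) pt_eq_iff) auto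
    then have "u' * (u + v) + v' * v = 0" by (simp add: algebra_simps)
    moreover have "u' * (u + v) \<ge> 0" "v' * v \<ge> 0" using uv uv' by simp_all
    ultimately have z: "u' * (u + v) = 0" "v' * v = 0" by linarith+
    then have "u' = 0" using uv by simp
    then have "v = 0" using z uv' by simp
    then have "x = Fin 1" using x uv by (simp add: pt_def)
    then show False using assms(1) by (simp add: ratpt_Fin)
  qed
  show ?thesis using * assms by (cases q; cases q') auto
qed

text \<open>
  Cylinders of words of the same length overlap in rational endpoints only; so an irrational
  point determines the word.
\<close>

lemma cylinder_word_unique:
  assumes "\<not> ratpt x" "x \<in> cylinder w" "x \<in> cylinder w'" "length w = length w'"
  shows "w = w'"
  using assms(4,1-3)
proof (induction w w' arbitrary: x rule: list_induct2)
  case (Cons q w q' w')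
  have q: "q = q'" using Cons.prems cylinder_Cons_letter by blast
  have c: "cylinder (r # v) = mobius (proj_letter r) ` cylinder v" for r v
    using cylinder_append [of "[r]" v] by simp
  have g: "gl2 (proj_letter q)" by (cases q) (simp_all add: gl2_def)
  obtain y where y: "y \<in> cylinder w" "x = mobius (proj_letter q) y" using Cons.prems c by auto
  obtain z where z: "z \<in> cylinder w'" "x = mobius (proj_letter q) z" using Cons.prems c q by auto
  have "y = z" using y z inj_mobius [OF g] by (auto dest: injD)
  then show ?case using Cons.IH [of y] y z q Cons.prems(1) ratpt_mobius [OF g] by simp
qed simp

section \<open>Periodic sequences and their reversal\<close>

definition has_period :: "nat \<Rightarrow> (nat \<Rightarrow> 'a) \<Rightarrow> bool" where
  "has_period p x \<longleftrightarrow> p \<ge> 1 \<and> (\<forall>t. x (t + p) = x t)"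

lemma purely_periodic_iff: "purely_periodic x \<longleftrightarrow> (\<exists>p. has_period p x)"
  by (auto simp: purely_periodic_def has_period_def)

lemma period_alt: "period x = (LEAST p. has_period p x)"
  by (simp add: period_def has_period_def)

lemma has_period_period: "purely_periodic x \<Longrightarrow> has_period (period x) x"
  unfolding purely_periodic_iff period_alt by (metis LeastI)

lemma has_period_mod:
  assumes "has_period p x" shows "x (t mod p) = x t"
proof -
  have "x (s + k * p) = x s" for s k
  proof (induction k)
    case (Suc k)
    have "x (s + Suc k * p) = x ((s + k * p) + p)" by (simp add: algebra_simps)
    then show ?case using Suc assms by (simp add: has_period_def)
  qed simp
  then have "x (t mod p + (t div p) * p) = x (t mod p)" by blast
  then show ?thesis by simp
qed

definition shift :: "nat \<Rightarrow> (nat \<Rightarrow> 'a) \<Rightarrow> nat \<Rightarrow> 'a" where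
  "shift k a = (\<lambda>t. a (k + t))"

lemma shift_0 [simp]: "shift 0 a = a"
  by (simp add: shift_def)

lemma shift_apply [simp]: "shift k a t = a (k + t)"
  by (simp add: shift_def)

lemma shift_shift [simp]: "shift j (shift k a) = shift (k + j) a"
  by (simp add: shift_def add_ac)

lemma shift_comp: "shift t (f \<circ> b) = f \<circ> shift t b"
  by (simp add: shift_def fun_eq_iff)

lemma has_period_shift:
  assumes "has_period p x" shows "shift (k * p) x = x"
  using has_period_mod [OF assms, of "k * p + t" for t] has_period_mod [OF assms]
  by (simp add: fun_eq_iff)

lemma has_period_nat_mod:
  assumes "has_period p x" "has_period q x"
  shows "x (nat (z mod int p)) = x (nat (z mod int q))"
proof -
  have *: "x (nat (z mod int r)) = x (nat (z mod (int p * int q)))"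
    if r: "has_period r x" "int r dvd int p * int q" for r
  proof -
    have p: "p \<ge> 1" "q \<ge> 1" "r \<ge> 1" using assms r by (auto simp: has_period_def)
    have "z mod int r = z mod (int p * int q) mod int r" using r by (simp add: mod_mod_cancel)
    also have "nat \<dots> = nat (z mod (int p * int q)) mod r"
      using p by (simp add: nat_mod_distrib)
    finally show ?thesis using has_period_mod [OF r(1)] by metis
  qed
  show ?thesis using * [OF assms(1)] * [OF assms(2)] by simp
qed

lemma has_period_Suc_mod:
  assumes "has_period q x"
  shows "x (Suc (nat (z mod int q))) = x (nat ((z + 1) mod int q))"
proof -
  have q: "int q > 0" using assms by (simp add: has_period_def)
  then have "int (Suc (nat (z mod int q)) mod q) = (z mod int q + 1) mod int q"
    by (simp add: zmod_int add.commute)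
  also have "\<dots> = (z + 1) mod int q" by (rule mod_add_left_eq)
  finally have "nat ((z + 1) mod int q) = Suc (nat (z mod int q)) mod q" by simp
  then show ?thesis using has_period_mod [OF assms, of "Suc (nat (z mod int q))"] by simp
qed

text \<open>
  A sequence of period \<open>p\<close> extends to all integers; \<open>reflect c p x\<close> reads the extension
  backwards, beginning at \<open>c\<close>.
\<close>

definition reflect :: "int \<Rightarrow> nat \<Rightarrow> (nat \<Rightarrow> 'a) \<Rightarrow> nat \<Rightarrow> 'a" where
  "reflect c p x = (\<lambda>t. x (nat ((c - int t) mod int p)))"

lemma reflect_indep:
  "has_period p x \<Longrightarrow> has_period q x \<Longrightarrow> reflect c p x = reflect c q x"
  unfolding reflect_def using has_period_nat_mod by blast

lemma reflect_has_period:
  assumes "has_period p x" "has_period q x"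
  shows "has_period q (reflect c p x)"
proof -
  have "(c - int (t + q)) mod int q = (c - int t) mod int q" for t
  proof -
    have "c - int (t + q) = (c - int t) + (- 1) * int q" by simp
    then show ?thesis by (metis mod_mult_self1)
  qed
  then have "has_period q (reflect c q x)" using assms by (simp add: has_period_def reflect_def)
  then show ?thesis using reflect_indep [OF assms] by simp
qed

lemma reflect_reflect:
  assumes "has_period p x"
  shows "reflect c p (reflect c p x) = x"
proof
  fix t
  have p: "int p > 0" using assms by (simp add: has_period_def)
  have "(c - (c - int t) mod int p) mod int p = int t mod int p"
    by (simp add: mod_diff_right_eq)
  then have "reflect c p (reflect c p x) t = x (t mod p)"
    using p by (simp add: reflect_def nat_mod_distrib)
  then show "reflect c p (reflect c p x) t = x t" using has_period_mod [OF assms] by simp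
qed

lemma period_reflect:
  assumes "has_period p x" shows "period (reflect c p x) = period x"
proof -
  have "has_period q (reflect c p x) \<longleftrightarrow> has_period q x" for q
    using reflect_has_period [OF assms] reflect_has_period [OF reflect_has_period [OF assms assms]]
      reflect_reflect [OF assms] by metis
  then show ?thesis by (simp add: period_alt)
qed

lemma map_reflect:
  "map (reflect (-1) p x) [0..<p] = rev (map x [0..<p])"
proof (rule nth_equalityI)
  fix t assume "t < length (map (reflect (-1) p x) [0..<p])"
  then have t: "t < p" by simp
  have "(- 1 - int t) mod int p = (- 1 - int t + int p) mod int p" by simp
  also have "- 1 - int t + int p = int (p - Suc t)" using t by simp
  also have "\<dots> mod int p = int (p - Suc t)" using t by (intro mod_pos_pos_trivial) auto
  finally have "nat ((- 1 - int t) mod int p) = p - Suc t" by simp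
  then show "map (reflect (-1) p x) [0..<p] ! t = rev (map x [0..<p]) ! t"
    using t by (simp add: reflect_def rev_nth)
qed simp

section \<open>Walks and codes\<close>

fun walk :: "nat \<Rightarrow> edge list \<Rightarrow> nat \<Rightarrow> bool" where
  "walk i [] j \<longleftrightarrow> i = j"
| "walk i (a # as) j \<longleftrightarrow> src a = i \<and> walk (tgt a) as j"

definition label :: "edge list \<Rightarrow> sg" where
  "label as = prod_list (map lab as)"

lemma label_simps [simp]:
  "label [] = 1" "label (a # as) = lab a * label as" "label (as @ bs) = label as * label bs"
  by (simp_all add: label_def)

lemma walk_append: "walk i (as @ bs) j \<longleftrightarrow> (\<exists>k. walk i as k \<and> walk k bs j)"
  by (induction as arbitrary: i) auto

text \<open>A product in the partial monoid is a walk together with the product of its labels.\<close>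

lemma edge_prod_walk:
  "as \<noteq> [] \<Longrightarrow> edge_prod as = Some c \<longleftrightarrow> walk (src c) as (tgt c) \<and> lab c = label as"
proof (induction as arbitrary: c rule: edge_prod.induct)
  case (2 a)
  then show ?case by (cases a; cases c) (auto simp: src_def lab_def tgt_def)
next
  case (3 a b as)
  have "edge_prod (a # b # as) = Some c \<longleftrightarrow>
      (\<exists>d. edge_prod (b # as) = Some d \<and> edge_mult a d = Some c)"
    by (simp add: bind_eq_Some_conv)
  also have "\<dots> \<longleftrightarrow> (\<exists>d. walk (src d) (b # as) (tgt d) \<and> lab d = label (b # as) \<and> edge_mult a d = Some c)"
    using 3 by simp
  also have "\<dots> \<longleftrightarrow> walk (src c) (a # b # as) (tgt c) \<and> lab c = label (a # b # as)"
    by (cases c) (auto simp: edge_mult_def src_def lab_def tgt_def split: if_splits)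
  finally show ?case .
qed simp

lemma code_walk_unique:
  assumes "is_code n A" "set as \<subseteq> A" "set bs \<subseteq> A" "as \<noteq> []" "bs \<noteq> []"
    "walk i as j" "walk i bs j" "label as = label bs"
  shows "as = bs"
proof -
  have "edge_prod as = Some (i, label as, j)" "edge_prod bs = Some (i, label as, j)"
    using assms by (simp_all add: edge_prod_walk) (simp_all add: src_def tgt_def lab_def)
  then show ?thesis using assms by (auto simp: is_code_def)
qed

lemma sg_mult_simps [simp]:
  "sg_len (x * y) = sg_len x + sg_len y" "sg_flip (x * y) \<longleftrightarrow> sg_flip x \<noteq> sg_flip y"
  "sg_len 1 = 0" "\<not> sg_flip 1"
  by (cases x; cases y; simp add: sg_len_def one_sg_def)+

lemma sg_word_mult: "\<exists>v. sg_word (x * y) = sg_word x @ v"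
  by (cases x; cases y) simp

text \<open>
  A loop of length 0 carries the label 1 or f, so running through it twice and through it four
  times gives the same product.
\<close>

lemma code_loop_length_pos:
  assumes "is_code n A" "set as \<subseteq> A" "as \<noteq> []" "walk i as i"
  shows "sg_len (label as) > 0"
proof (rule ccontr)
  assume "\<not> ?thesis"
  then obtain e where e: "label as = Sg [] e" by (cases "label as") (auto simp: sg_len_def)
  then have 1: "label (as @ as) = 1" by (simp add: one_sg_def)
  have w: "walk i (as @ as) i" using assms by (auto simp: walk_append)
  have "as @ as = (as @ as) @ (as @ as)"
  proof (rule code_walk_unique [OF assms(1)])
    show "label (as @ as) = label ((as @ as) @ as @ as)" unfolding label_simps(3) [of "as @ as"] 1 by simp
    show "walk i ((as @ as) @ as @ as) i" using w walk_append by blast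
  qed (use assms w in auto)
  then show False using assms by simp
qed

definition path_label :: "(nat \<Rightarrow> edge) \<Rightarrow> nat \<Rightarrow> sg" where
  "path_label a t = label (map a [0..<t])"

lemma path_label_0 [simp]: "path_label a 0 = 1"
  by (simp add: path_label_def)

lemma path_label_Suc: "path_label a (Suc t) = path_label a t * lab (a t)"
  by (simp add: path_label_def)

lemma path_label_add: "path_label a (s + t) = path_label a s * path_label (shift s a) t"
  by (induction t) (simp_all add: path_label_Suc mult.assoc)

lemma paths_shift: "a \<in> paths A i \<Longrightarrow> shift k a \<in> paths A (src (a k))"
  by (simp add: paths_def)

lemma paths_walk: "a \<in> paths A i \<Longrightarrow> walk i (map a [0..<t]) (src (a t))"
  by (induction t) (auto simp: walk_append paths_def)

lemma paths_src: "a \<in> paths A i \<Longrightarrow> src (a 0) = i"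
  by (simp add: paths_def)

lemma paths_mem: "a \<in> paths A i \<Longrightarrow> a t \<in> A"
  by (simp add: paths_def)

lemma paths_tgt: "a \<in> paths A i \<Longrightarrow> tgt (a t) = src (a (Suc t))"
  by (simp add: paths_def)

lemma paths_set: "a \<in> paths A i \<Longrightarrow> set (map a [0..<t]) \<subseteq> A"
  by (auto simp: paths_def)

lemma code_path_loop_pos:
  assumes "is_code n A" "a \<in> paths A i" "src (a t) = i" "t \<ge> 1"
  shows "sg_len (path_label a t) > 0"
  unfolding path_label_def
  using code_loop_length_pos [OF assms(1) paths_set [OF assms(2)], of t i] paths_walk [OF assms(2), of t] assms
  by simp

lemma code_path_src: "is_code n A \<Longrightarrow> a \<in> paths A i \<Longrightarrow> src (a t) < n"
  by (auto simp: is_code_def Sigma_tilde_def paths_def)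

text \<open>
  Some node recurs infinitely often, and between two visits the length grows.
\<close>

lemma code_path_unbounded:
  assumes "is_code n A" "a \<in> paths A i"
  shows "\<exists>t. sg_len (path_label a t) \<ge> N"
proof (rule ccontr)
  assume "\<not> ?thesis"
  then have bounded: "sg_len (path_label a t) < N" for t by (simp add: not_le)
  have "finite ((\<lambda>t. src (a t)) ` UNIV)"
    using code_path_src [OF assms] by (intro finite_subset [OF _ finite_lessThan [of n]]) auto
  then obtain t0 where inf: "infinite {t. src (a t) = src (a t0)}"
    using pigeonhole_infinite [of "UNIV :: nat set" "\<lambda>t. src (a t)"] by auto
  let ?T = "{t. src (a t) = src (a t0)}"
  have less: "sg_len (path_label a s) < sg_len (path_label a t)" if st: "s \<in> ?T" "t \<in> ?T" "s < t" for s t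
  proof -
    have "path_label a t = path_label a s * path_label (shift s a) (t - s)" using st path_label_add [of a s "t - s"] by simp
    moreover have "sg_len (path_label (shift s a) (t - s)) > 0"
      using code_path_loop_pos [OF assms(1) paths_shift [OF assms(2)], of s "t - s"] st by simp
    ultimately show ?thesis by simp
  qed
  have "inj_on (\<lambda>t. sg_len (path_label a t)) ?T"
    by (rule inj_onI) (metis less less_irrefl linorder_less_linear)
  moreover have "(\<lambda>t. sg_len (path_label a t)) ` ?T \<subseteq> {..<N}" using bounded by auto
  ultimately show False using inf by (meson finite_lessThan finite_subset finite_imageD)
qed

section \<open>The point of a path\<close>

lemma gl2_proj: "gl2 (proj s)"
proof (cases s)
  case (Sg w e)
  then show ?thesis using gl2_mult [OF gl2_proj_word, of proj_f w] gl2_mult [OF gl2_proj_word gl2_one, of w]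
    by (simp add: gl2_def proj_f_def gl2_proj_word)
qed

lemma proj_f_nonneg: "mobius proj_f ` nonneg = nonneg"
proof -
  have sub: "mobius proj_f x \<in> nonneg" if "x \<in> nonneg" for x
  proof -
    obtain u v where uv: "x = pt u v" "u \<ge> 0" "v \<ge> 0" "u + v > 0"
      using \<open>x \<in> nonneg\<close> by (rule nonnegE)
    then have "u \<noteq> 0 \<or> v \<noteq> 0" by auto
    then show ?thesis using uv by (simp add: proj_f_def mobius_mat22_pt nonneg_pt)
  qed
  have g: "gl2 proj_f" by (simp add: gl2_def proj_f_def)
  have "mobius proj_f (mobius proj_f x) = x" for x
    using mobius_mult [OF g, of proj_f x] by (simp add: proj_f_def mat22_mult flip: mat_1_mat22)
  then show ?thesis using sub by (metis image_iff subsetI subset_antisym image_subsetI)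
qed

lemma proj_nonneg: "mobius (proj s) ` nonneg = cylinder (sg_word s)"
proof (cases s)
  case (Sg w e)
  have g: "gl2 proj_f" by (simp add: gl2_def proj_f_def)
  show ?thesis using proj_f_nonneg by (simp add: Sg cylinder_def mobius_image_mult [OF g])
qed

lemma interval_nonneg: "interval M = mobius M ` nonneg"
  by (simp add: interval_def nonneg_def)

text \<open>
  A locale, because the dual continued fraction will be a second instance of it.
\<close>

locale cf_system =
  fixes n :: nat and A :: "edge set" and I :: "nat \<Rightarrow> int^2^2"
  assumes code: "is_code n A"
    and gl2_I: "\<And>i. i < n \<Longrightarrow> gl2 (I i)"
begin

lemma edge_nodes: "a \<in> A \<Longrightarrow> src a < n \<and> tgt a < n"
  using code by (auto simp: is_code_def Sigma_tilde_def)

lemma path_node: "a \<in> paths A i \<Longrightarrow> src (a t) < n"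
  using code_path_src [OF code] by blast

lemma path_start: "a \<in> paths A i \<Longrightarrow> i < n"
  using path_node [of a i 0] paths_src by blast

lemma gl2_Bmat: "a \<in> A \<Longrightarrow> gl2 (Bmat I a)"
  using edge_nodes by (simp add: Bmat_def gl2_mult gl2_proj gl2_matrix_inv gl2_I)

lemma Bmat_I: "a \<in> A \<Longrightarrow> Bmat I a ** I (tgt a) = I (src a) ** proj (lab a)"
  using edge_nodes [of a] gl2_I [of "tgt a"]
  by (simp add: Bmat_def matrix_mul_assoc [symmetric] matrix_inv_gl2)

lemma gl2_seq_prod: "a \<in> paths A i \<Longrightarrow> gl2 (seq_prod (Bmat I) a t)"
  by (induction t) (simp_all add: gl2_one gl2_mult gl2_Bmat paths_mem)

text \<open>The matrices of the intermediate nodes cancel.\<close>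

lemma seq_prod_I:
  assumes a: "a \<in> paths A i"
  shows "seq_prod (Bmat I) a t ** I (src (a t)) = I i ** proj (path_label a t)"
proof (induction t)
  case 0
  then show ?case using a by (simp add: paths_src proj_one)
next
  case (Suc t)
  have "seq_prod (Bmat I) a (Suc t) ** I (src (a (Suc t))) =
      seq_prod (Bmat I) a t ** (Bmat I (a t) ** I (tgt (a t)))"
    using a by (simp add: matrix_mul_assoc paths_tgt)
  also have "\<dots> = (seq_prod (Bmat I) a t ** I (src (a t))) ** proj (lab (a t))"
    using a by (simp add: Bmat_I paths_mem matrix_mul_assoc)
  also have "\<dots> = I i ** proj (path_label a (Suc t))"
    by (simp add: Suc path_label_Suc proj_mult matrix_mul_assoc)
  finally show ?case .
qed

lemma path_cell:
  assumes a: "a \<in> paths A i"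
  shows "mobius (seq_prod (Bmat I) a t) ` interval (I (src (a t))) =
    mobius (I i) ` cylinder (sg_word (path_label a t))"
proof -
  have "mobius (seq_prod (Bmat I) a t) ` interval (I (src (a t))) =
      mobius (seq_prod (Bmat I) a t ** I (src (a t))) ` nonneg"
    by (simp add: interval_nonneg mobius_image_mult gl2_I path_node [OF a])
  also have "\<dots> = mobius (I i) ` mobius (proj (path_label a t)) ` nonneg"
    by (simp add: seq_prod_I [OF a] mobius_image_mult gl2_proj)
  finally show ?thesis by (simp add: proj_nonneg)
qed

lemma cf_point_unique_exists:
  assumes a: "a \<in> paths A i"
  shows "\<exists>!x. \<forall>t. x \<in> mobius (I i) ` cylinder (sg_word (path_label a t))"
proof -
  have g: "gl2 (I i)" using gl2_I path_start [OF a] by blast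
  have "\<exists>!x. \<forall>t. x \<in> cylinder (sg_word (path_label a t))"
  proof (rule nested_cylinders_point)
    show "\<exists>v. sg_word (path_label a (Suc t)) = sg_word (path_label a t) @ v" for t
      unfolding path_label_Suc by (rule sg_word_mult)
    show "\<exists>t. N \<le> length (sg_word (path_label a t))" for N
      using code_path_unbounded [OF code a] by (simp add: sg_len_def)
  qed
  then obtain x where x: "\<forall>t. x \<in> cylinder (sg_word (path_label a t))"
    and uniq: "\<And>y. \<forall>t. y \<in> cylinder (sg_word (path_label a t)) \<Longrightarrow> y = x" by blast
  show ?thesis
  proof (rule ex1I [of _ "mobius (I i) x"])
    show "\<forall>t. mobius (I i) x \<in> mobius (I i) ` cylinder (sg_word (path_label a t))" using x by blast
  next
    fix y assume y: "\<forall>t. y \<in> mobius (I i) ` cylinder (sg_word (path_label a t))"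
    have "mobius (matrix_inv (I i)) y \<in> cylinder (sg_word (path_label a t))" for t
      using y g by (auto dest: spec [of _ t])
    then have "mobius (matrix_inv (I i)) y = x" using uniq by blast
    then show "y = mobius (I i) x" using mobius_inv_right [OF g, of y] by simp
  qed
qed

lemma cf_point_iff:
  assumes a: "a \<in> paths A i"
  shows "cf_point I a = x \<longleftrightarrow> (\<forall>t. x \<in> mobius (I i) ` cylinder (sg_word (path_label a t)))"
proof -
  have "cf_point I a = (THE x. \<forall>t. x \<in> mobius (I i) ` cylinder (sg_word (path_label a t)))"
    by (simp add: cf_point_def path_cell [OF a])
  then show ?thesis using theI' [OF cf_point_unique_exists [OF a]] cf_point_unique_exists [OF a] by metis
qed

lemma cf_point_cell:
  "a \<in> paths A i \<Longrightarrow> cf_point I a \<in> mobius (I i) ` cylinder (sg_word (path_label a t))"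
  using cf_point_iff by blast

lemma cf_point_interval:
  assumes "a \<in> paths A i" shows "cf_point I a \<in> interval (I i)"
  using cf_point_cell [OF assms, of 0] cylinder_subset_nonneg by (auto simp: interval_nonneg)

text \<open>
  Points that are related by the maps along the path and lie in the intervals of its nodes put the
  first of them into all the nested intervals.
\<close>

lemma cf_point_eqI:
  assumes a: "a \<in> paths A i"
    and step: "\<And>t. y t = mobius (Bmat I (a t)) (y (Suc t))"
    and mem: "\<And>t. y t \<in> interval (I (src (a t)))"
  shows "cf_point I a = y 0"
  unfolding cf_point_iff [OF a]
proof
  fix t
  have "y 0 = mobius (seq_prod (Bmat I) a t) (y t)"
  proof (induction t)
    case (Suc t)
    then show ?case using step [of t] a by (simp add: mobius_mult gl2_Bmat paths_mem)
  qed simp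
  then show "y 0 \<in> mobius (I i) ` cylinder (sg_word (path_label a t))"
    using mem by (metis imageI path_cell [OF a])
qed

lemma cf_point_step:
  assumes a: "a \<in> paths A i"
  shows "cf_point I a = mobius (Bmat I (a 0)) (cf_point I (shift 1 a))"
  unfolding cf_point_iff [OF a]
proof
  fix t
  let ?z = "cf_point I (shift 1 a)"
  have a1: "shift 1 a \<in> paths A (src (a 1))" by (rule paths_shift [OF a])
  have *: "seq_prod M a (Suc s) = M (a 0) ** seq_prod M (shift 1 a) s" for M s
    by (induction s) (simp_all add: matrix_mul_assoc)
  have suc: "mobius (Bmat I (a 0)) ?z \<in> mobius (I i) ` cylinder (sg_word (path_label a (Suc s)))" for s
  proof -
    have "?z \<in> mobius (seq_prod (Bmat I) (shift 1 a) s) ` interval (I (src (shift 1 a s)))"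
      using cf_point_cell [OF a1] path_cell [OF a1] by blast
    then have "mobius (Bmat I (a 0)) ?z \<in> mobius (Bmat I (a 0)) `
        mobius (seq_prod (Bmat I) (shift 1 a) s) ` interval (I (src (shift 1 a s)))"
      by blast
    then have "mobius (Bmat I (a 0)) ?z \<in>
        mobius (seq_prod (Bmat I) a (Suc s)) ` interval (I (src (a (Suc s))))"
      unfolding * mobius_image_mult [OF gl2_seq_prod [OF a1]] by simp
    then show ?thesis by (simp only: path_cell [OF a])
  qed
  show "mobius (Bmat I (a 0)) ?z \<in> mobius (I i) ` cylinder (sg_word (path_label a t))"
  proof (cases t)
    case 0
    then show ?thesis using suc [of 0] cylinder_antimono [of "[]" "sg_word (path_label a 1)"]
      by (auto simp: one_sg_def)
  qed (use suc in simp)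
qed

lemma cf_point_shift:
  assumes a: "a \<in> paths A i"
  shows "cf_point I (shift t a) = mobius (Bmat I (a t)) (cf_point I (shift (Suc t) a))"
  using cf_point_step [OF paths_shift [OF a, of t]] by simp

lemma cf_point_seq_prod:
  assumes a: "a \<in> paths A i"
  shows "cf_point I a = mobius (seq_prod (Bmat I) a t) (cf_point I (shift t a))"
proof (induction t)
  case (Suc t)
  then show ?case using cf_point_shift [OF a, of t]
    by (simp add: mobius_mult gl2_Bmat paths_mem [OF a] del: shift_apply)
qed simp

section \<open>Uniqueness of periodic expansions\<close>

text \<open>
  An element of the monoid is known from its word and its flip, and the word is read off from the
  irrational point as soon as its length is known.
\<close>

lemma label_determined:
  assumes a: "a \<in> paths A i" and irr: "\<not> ratpt (cf_point I a)"
    and s: "mobius (matrix_inv (I i)) (cf_point I a) \<in> cylinder (sg_word s)"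
      "sg_len s = sg_len (path_label a t)" "sg_flip s = sg_flip (path_label a t)"
  shows "s = path_label a t"
proof (rule sg.expand, intro conjI)
  have g: "gl2 (I i)" using gl2_I path_start [OF a] by blast
  show "sg_word s = sg_word (path_label a t)"
  proof (rule cylinder_word_unique)
    show "\<not> ratpt (mobius (matrix_inv (I i)) (cf_point I a))" using irr g by (simp add: gl2_matrix_inv)
    show "mobius (matrix_inv (I i)) (cf_point I a) \<in> cylinder (sg_word (path_label a t))"
      using cf_point_cell [OF a, of t] g by auto
  qed (use s in \<open>auto simp: sg_len_def\<close>)
qed (rule s)

lemma period_fixes_point:
  assumes a: "a \<in> paths A i" and per: "has_period q a"
  shows "mobius (seq_prod (Bmat I) a q) (cf_point I a) = cf_point I a"
    and "mobius (proj (path_label a q)) (mobius (matrix_inv (I i)) (cf_point I a)) =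
      mobius (matrix_inv (I i)) (cf_point I a)"
proof -
  have g: "gl2 (I i)" using gl2_I path_start [OF a] by blast
  have sh: "shift q a = a" using has_period_shift [OF per, of 1] by simp
  then show fixed: "mobius (seq_prod (Bmat I) a q) (cf_point I a) = cf_point I a"
    using cf_point_seq_prod [OF a, of q] by simp
  have "src (a q) = i" using fun_cong [OF sh, of 0] paths_src [OF a] by simp
  then have e: "seq_prod (Bmat I) a q ** I i = I i ** proj (path_label a q)"
    using seq_prod_I [OF a, of q] by simp
  have "mobius (I i) (mobius (proj (path_label a q)) (mobius (matrix_inv (I i)) (cf_point I a))) =
      mobius (seq_prod (Bmat I) a q ** I i) (mobius (matrix_inv (I i)) (cf_point I a))"
    by (simp add: e mobius_mult gl2_proj)
  also have "\<dots> = cf_point I a" using g by (simp add: mobius_mult fixed)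
  finally show "mobius (proj (path_label a q)) (mobius (matrix_inv (I i)) (cf_point I a)) =
      mobius (matrix_inv (I i)) (cf_point I a)" using g by (metis mobius_inv_left)
qed

text \<open>
  Let \<open>u\<close> be the label of twice the period of \<open>a\<close> (the doubling removes a possible f).  The
  letters read along \<open>a\<close> and along \<open>b\<close> are determined by the common irrational point, so
  both spell \<open>uuu\<dots>\<close>.  If \<open>b\<close> visits a node at two times with the same
  flip and with positions congruent modulo the length of \<open>u\<close>, and \<open>X\<close> and \<open>X'\<close> are the
  labels read until then, then \<open>X' = u\<^sup>k X\<close>.  This is an equality between two products of
  elements of the code, hence \<open>b\<close> begins with \<open>k\<close> copies of the doubled period of \<open>a\<close>.  Some
  such place of the period is visited infinitely often, so \<open>k\<close> may be taken as large as one likes.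
\<close>

lemma periodic_expansion_unique:
  assumes a: "a \<in> paths A i" and b: "b \<in> paths A i"
    and eq: "cf_point I a = cf_point I b" and irr: "\<not> ratpt (cf_point I a)"
    and per: "has_period p a"
  shows "b = a"
proof -
  \<comment> \<open>a label that is a square contains no f\<close>
  define P where "P = 2 * p"
  define \<xi> where "\<xi> = mobius (matrix_inv (I i)) (cf_point I a)"
  have g: "gl2 (I i)" using gl2_I path_start [OF a] by blast
  have p: "p \<ge> 1" using per by (simp add: has_period_def)
  note sh = has_period_shift [OF per]
  have "path_label a P = path_label a p * path_label a p"
    using path_label_add [of a p p] sh [of 1] by (simp add: P_def mult_2)
  then have Pflip: "\<not> sg_flip (path_label a P)" by simp
  have kP: "path_label a (Suc k * P) = path_label a P * path_label a (k * P)" for k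
    using path_label_add [of a P "k * P"] sh [of 2] by (simp add: P_def)
  define L where "L = sg_len (path_label a P)"
  have flip: "\<not> sg_flip (path_label a (k * P))" and len: "sg_len (path_label a (k * P)) = k * L" for k
    by (induction k) (simp_all add: kP Pflip L_def del: mult_Suc, simp)
  have node: "src (a (k * P)) = i" for k
    using fun_cong [OF sh [of "k * 2"], of 0] paths_src [OF a] by (simp add: P_def mult.assoc)
  have L: "L > 0"
    unfolding L_def using code_path_loop_pos [OF code a] node [of 1] p by (simp add: P_def)
  \<comment> \<open>the place within the doubled period, of which there are finitely many; time 0 is left out
    since the code property compares nonempty products only\<close>
  define st where "st t = (src (b t), sg_flip (path_label b t), sg_len (path_label b t) mod L)" for t
  have "st ` {1..} \<subseteq> {..<n} \<times> UNIV \<times> {..<L}" using L path_node [OF b] by (auto simp: st_def)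
  then have "finite (st ` {1..})" by (rule finite_subset) simp
  then obtain s where s: "s \<ge> 1" "infinite {t \<in> {1..}. st t = st s}"
    using pigeonhole_infinite [OF infinite_Ici [of "1::nat"]] by fastforce
  have "b r = a r" for r
  proof -
    obtain t where t: "t > s + r" "st t = st s" "t \<ge> 1"
      using s(2) unfolding infinite_nat_iff_unbounded by blast
    have "path_label b t = path_label b s * path_label (shift s b) (t - s)"
      using path_label_add [of b s "t - s"] t by simp
    then have "sg_len (path_label b s) \<le> sg_len (path_label b t)" by simp
    moreover have "sg_len (path_label b t) mod L = sg_len (path_label b s) mod L" using t by (simp add: st_def)
    ultimately obtain k where k: "sg_len (path_label b t) = sg_len (path_label b s) + k * L"
      by (metis mod_eq_nat2E mult.commute add.commute)
    define X where "X = path_label a (k * P) * path_label b s"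
    have fixed: "mobius (proj (path_label a (k * P))) \<xi> = \<xi>"
    proof (cases "k = 0")
      case False
      have "a (t + k * P) = a t" for t
        using fun_cong [OF sh [of "k * 2"], of t] by (simp add: P_def mult.assoc add.commute)
      then have "has_period (k * P) a" using False p by (simp add: has_period_def P_def)
      then show ?thesis unfolding \<xi>_def by (rule period_fixes_point(2) [OF a])
    qed (simp add: proj_one)
    have in_b: "\<xi> \<in> cylinder (sg_word (path_label b s))"
      unfolding \<xi>_def eq using cf_point_cell [OF b, of s] g by auto
    have "\<xi> \<in> mobius (proj (path_label a (k * P))) ` mobius (proj (path_label b s)) ` nonneg"
      using in_b fixed unfolding proj_nonneg by (metis imageI)
    then have "\<xi> \<in> cylinder (sg_word X)"
      unfolding X_def proj_nonneg [symmetric] proj_mult by (simp add: mobius_image_mult gl2_proj)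
    then have X: "X = path_label b t"
      using label_determined [OF b, of X t] irr t(2) k
      by (simp add: eq \<xi>_def X_def flip len st_def)
    have "map b [0..<t] = map a [0..<k * P] @ map b [0..<s]"
    proof (rule code_walk_unique [OF code])
      show "walk i (map b [0..<t]) (src (b s))" using paths_walk [OF b, of t] t(2) by (simp add: st_def)
      show "walk i (map a [0..<k * P] @ map b [0..<s]) (src (b s))"
        using paths_walk [OF a, of "k * P"] paths_walk [OF b, of s] node [of k] by (auto simp: walk_append)
      show "label (map b [0..<t]) = label (map a [0..<k * P] @ map b [0..<s])"
        using X by (simp add: X_def path_label_def)
    qed (use a b s t in \<open>auto simp: paths_def\<close>)
    moreover from this have "t = k * P + s" by (metis length_append length_map length_upt diff_zero)
    then have "r < k * P" using t by simp
    ultimately show "b r = a r" using t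
      by (metis (no_types, lifting) add_lessD1 add_0 diff_zero length_map length_upt
          nth_append nth_map nth_upt less_trans add.commute)
  qed
  then show ?thesis by blast
qed

text \<open>
  Repeating the first \<open>q\<close> steps gives a periodic path with the same point, and periodic
  expansions are unique.
\<close>

lemma recurrence_forces_period:
  assumes a: "a \<in> paths A i" and q: "q \<ge> 1" "src (a q) = i"
    and eq: "cf_point I (shift q a) = cf_point I a" and irr: "\<not> ratpt (cf_point I a)"
  shows "has_period q a"
proof -
  define c where "c m = a (m mod q)" for m
  have c: "c \<in> paths A i"
    unfolding paths_def
  proof (safe)
    show "c t \<in> A" for t using a by (simp add: c_def paths_mem)
    show "src (c 0) = i" using a by (simp add: c_def paths_src)
    show "tgt (c t) = src (c (Suc t))" for t
      using paths_tgt [OF a, of "t mod q"] q paths_src [OF a] by (auto simp: c_def mod_Suc)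
  qed
  have "cf_point I c = cf_point I (shift (0 mod q) a)"
  proof (rule cf_point_eqI [OF c])
    fix t
    show "cf_point I (shift (t mod q) a) = mobius (Bmat I (c t)) (cf_point I (shift (Suc t mod q) a))"
      using cf_point_shift [OF a, of "t mod q"] eq by (auto simp: c_def mod_Suc)
    show "cf_point I (shift (t mod q) a) \<in> interval (I (src (c t)))"
      using cf_point_interval [OF paths_shift [OF a]] by (simp add: c_def)
  qed
  then have "cf_point I c = cf_point I a" by simp
  moreover from this have "\<not> ratpt (cf_point I c)" using irr by simp
  moreover have per: "has_period q c" using q by (simp add: has_period_def c_def)
  ultimately have "a = c" using periodic_expansion_unique [OF c a] by blast
  then show ?thesis using per by simp
qed

end

section \<open>Quadratic irrationals and Galois conjugation\<close>

text \<open>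
  The numbers \<open>x\<close> and \<open>y\<close> are the irrational roots of \<open>a X\<^sup>2 + b X + c\<close>.  Vieta's formulas make
  the two roots interchangeable and are easily transformed by matrices.
\<close>

definition conj_roots :: "int \<Rightarrow> int \<Rightarrow> int \<Rightarrow> real \<Rightarrow> real \<Rightarrow> bool" where
  "conj_roots a b c x y \<longleftrightarrow> a \<noteq> 0 \<and> x \<notin> \<rat> \<and>
     of_int a * (x + y) = - of_int b \<and> of_int a * (x * y) = of_int c"

lemma conj_roots_galois:
  assumes r: "conj_roots a b c x y"
  shows "quadratic_irrational x" "galois_conj x = y"
proof -
  define p :: "rat poly" where "p = [:of_int c, of_int b, of_int a:]"
  have a: "a \<noteq> 0" and x: "x \<notin> \<rat>" and s: "of_int a * (x + y) = - of_int b" "of_int a * (x * y) = of_int c"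
    using r by (auto simp: conj_roots_def)
  have "poly (map_poly of_rat p) x = of_int c + x * (of_int b + x * of_int a)"
    unfolding p_def by (cases "c = 0"; cases "b = 0"; cases "a = 0"; simp add: map_poly_pCons)
  also have "\<dots> = 0"
  proof -
    have b: "real_of_int b = - (of_int a * (x + y))" using s(1) by simp
    show ?thesis unfolding b s(2) [symmetric] by (simp add: algebra_simps)
  qed
  finally have p: "rat_quadratic_root p x" using a by (simp add: rat_quadratic_root_def p_def)
  then show "quadratic_irrational x" using x by (auto simp: quadratic_irrational_def)
  have "real_of_rat (coeff p 1 / coeff p 2) = of_int b / of_int a"
    by (simp add: p_def of_rat_divide numeral_2_eq_2)
  also have "\<dots> = - (x + y)"
  proof -
    have "real_of_int b = - (of_int a * (x + y))" using s(1) by simp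
    then show ?thesis using a by simp
  qed
  finally show "galois_conj x = y" using galois_conj_eq [OF p x] by simp
qed

text \<open>Clear the denominators of the rational polynomial.\<close>

lemma conj_roots_exist:
  assumes "quadratic_irrational x"
  obtains a b c where "conj_roots a b c x (galois_conj x)"
proof -
  obtain p where p: "rat_quadratic_root p x" and x: "x \<notin> \<rat>"
    using assms by (auto simp: quadratic_irrational_def)
  have d: "degree p = 2" and root: "poly (map_poly of_rat p) x = 0"
    using p by (auto simp: rat_quadratic_root_def)
  have num: "\<exists>m k. k \<noteq> 0 \<and> r = of_int m / of_int k" for r :: rat
    by (metis Fract_of_int_quotient Rat_cases of_int_eq_0_iff less_irrefl)
  obtain m0 k0 where c0: "k0 \<noteq> 0" "coeff p 0 = of_int m0 / of_int k0" using num by blast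
  obtain m1 k1 where c1: "k1 \<noteq> 0" "coeff p 1 = of_int m1 / of_int k1" using num by blast
  obtain m2 k2 where c2: "k2 \<noteq> 0" "coeff p 2 = of_int m2 / of_int k2" using num by blast
  have "coeff p 2 \<noteq> 0" using d by (metis leading_coeff_0_iff degree_0 zero_neq_numeral)
  then have m2: "m2 \<noteq> 0" using c2 by auto
  have "0 = of_rat (coeff p 0) + of_rat (coeff p 1) * x + of_rat (coeff p 2) * x\<^sup>2"
    using root d by (simp add: poly_altdef degree_map_poly coeff_map_poly numeral_2_eq_2)
  then have eq: "of_int m0 / of_int k0 + of_int m1 / of_int k1 * x + of_int m2 / of_int k2 * x\<^sup>2 = 0"
    by (simp add: c0 c1 c2 of_rat_divide del: One_nat_def)
  have g: "galois_conj x = - ((of_int m1 / of_int k1) / (of_int m2 / of_int k2)) - x"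
    using galois_conj_eq [OF p x] by (simp add: c1 c2 of_rat_divide of_rat_mult del: One_nat_def)
  define a b c where "a = m2 * k0 * k1" and "b = m1 * k0 * k2" and "c = m0 * k1 * k2"
  have a0: "a \<noteq> 0" using m2 c0 c1 by (simp add: a_def)
  have sum: "of_int a * (x + galois_conj x) = - of_int b"
    using m2 c0 c1 c2 by (simp add: g a_def b_def field_simps)
  have "of_int c + of_int b * x + of_int a * x\<^sup>2 =
      of_int k0 * of_int k1 * of_int k2 *
      (of_int m0 / of_int k0 + of_int m1 / of_int k1 * x + of_int m2 / of_int k2 * x\<^sup>2)"
    using c0 c1 c2 by (simp add: a_def b_def c_def field_simps)
  then have "of_int c = - of_int b * x - of_int a * x\<^sup>2" using eq by simp
  also have "\<dots> = of_int a * (x + galois_conj x) * x - of_int a * x\<^sup>2" by (simp add: sum)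
  also have "\<dots> = of_int a * (x * galois_conj x)" by (simp add: algebra_simps power2_eq_square)
  finally have "conj_roots a b c x (galois_conj x)" using a0 x sum by (simp add: conj_roots_def)
  then show ?thesis by (rule that)
qed

lemma conj_roots_swap: assumes "conj_roots a b c x y" shows "conj_roots a b c y x"
proof -
  have "y \<notin> \<rat>"
  proof
    assume y: "y \<in> \<rat>"
    have "x = - of_int b / of_int a - y" using assms by (auto simp: conj_roots_def field_simps)
    moreover have "- real_of_int b / of_int a - y \<in> \<rat>" using y by simp
    ultimately show False using assms by (simp add: conj_roots_def)
  qed
  then show ?thesis using assms by (simp add: conj_roots_def add.commute mult.commute)
qed

text \<open>
  The substitution of a matrix of determinant \<open>\<plusminus>1\<close> in a binary quadratic form preserves the
  discriminant.
\<close>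

lemma conj_roots_mobius:
  assumes g: "gl2 M" and r: "conj_roots a b c x y"
  obtains x' y' a' b' c' where "mobius M (Fin x) = Fin x'" "mobius M (Fin y) = Fin y'"
    "conj_roots a' b' c' x' y'" "b'\<^sup>2 - 4 * a' * c' = b\<^sup>2 - 4 * a * c"
proof -
  obtain p q s t where M: "M = mat22 p q s t" by (rule mat22_cases)
  have irr: "\<not> ratpt (mobius M (Fin x))" "\<not> ratpt (mobius M (Fin y))"
    using r conj_roots_swap [OF r] g by (simp_all add: ratpt_Fin conj_roots_def)
  have ev: "mobius M (Fin z) = pt (of_int p * z + of_int q) (of_int s * z + of_int t)" for z
    using mobius_mat22_pt [of z 1 p q s t] by (simp add: M pt_def)
  define D E where "D = of_int s * x + of_int t" and "E = of_int s * y + of_int t"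
  define P Q where "P = of_int p * x + of_int q" and "Q = of_int p * y + of_int q"
  have nz: "D \<noteq> 0" "E \<noteq> 0"
    using irr by (auto simp: ev D_def E_def pt_def ratpt_Infty split: if_splits)
  have fx: "mobius M (Fin x) = Fin (P / D)" "mobius M (Fin y) = Fin (Q / E)"
    using nz by (simp_all add: ev pt_def D_def E_def P_def Q_def)
  have eqs: "of_int a * x + of_int a * y = - of_int b" "of_int a * (x * y) = of_int c" and a: "a \<noteq> 0"
    using r by (simp_all add: conj_roots_def algebra_simps)
  \<comment> \<open>the form with the roots \<open>P / D\<close> and \<open>Q / E\<close>, multiplied by \<open>D E\<close> to make it integral\<close>
  define a' b' c' where "a' = s\<^sup>2 * c - s * t * b + t\<^sup>2 * a"
    and "b' = - (2 * p * s * c - (p * t + q * s) * b + 2 * q * t * a)"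
    and "c' = p\<^sup>2 * c - p * q * b + q\<^sup>2 * a"
  have b: "real_of_int b = - (of_int a * x + of_int a * y)" using eqs by simp
  have a': "of_int a' = of_int a * (D * E)"
    by (simp add: a'_def D_def E_def eqs(2) [symmetric] b power2_eq_square algebra_simps)
  have b': "- of_int b' = of_int a * (P * E + Q * D)"
    by (simp add: b'_def D_def E_def P_def Q_def eqs(2) [symmetric] b power2_eq_square algebra_simps)
  have c': "of_int c' = of_int a * (P * Q)"
    by (simp add: c'_def P_def Q_def eqs(2) [symmetric] b power2_eq_square algebra_simps)
  have "conj_roots a' b' c' (P / D) (Q / E)"
    unfolding conj_roots_def
  proof (intro conjI)
    have "real_of_int a' \<noteq> 0" using a nz by (simp add: a')
    then show "a' \<noteq> 0" by simp
    show "P / D \<notin> \<rat>" using irr(1) by (simp add: fx ratpt_Fin)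
    show "of_int a' * (P / D + Q / E) = - of_int b'" unfolding a' b' using nz by (simp add: field_simps)
    show "of_int a' * (P / D * (Q / E)) = of_int c'" unfolding a' c' using nz by (simp add: field_simps)
  qed
  moreover have "b'\<^sup>2 - 4 * a' * c' = b\<^sup>2 - 4 * a * c"
  proof -
    have "b'\<^sup>2 - 4 * a' * c' = (p * t - q * s)\<^sup>2 * (b\<^sup>2 - 4 * a * c)"
      by (simp add: a'_def b'_def c'_def power2_eq_square algebra_simps)
    moreover have "(p * t - q * s)\<^sup>2 = 1" using g by (auto simp: M gl2_def power2_eq_1_iff)
    ultimately show ?thesis by simp
  qed
  ultimately show ?thesis using that fx by blast
qed

definition quad_pt :: "p1 \<Rightarrow> bool" where
  "quad_pt z \<longleftrightarrow> (\<exists>x. z = Fin x \<and> quadratic_irrational x)"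

lemma quad_pt_Fin [simp]: "quad_pt (Fin x) \<longleftrightarrow> quadratic_irrational x"
  by (simp add: quad_pt_def)

lemma quad_pt_not_ratpt: "quad_pt z \<Longrightarrow> \<not> ratpt z"
  by (auto simp: quad_pt_def ratpt_Fin quadratic_irrational_def)

lemma quad_pt_conj:
  assumes "quad_pt z" shows "quad_pt (p1_conj z)" "p1_conj (p1_conj z) = z"
proof -
  obtain x where z: "z = Fin x" "quadratic_irrational x" using assms by (auto simp: quad_pt_def)
  then obtain a b c where "conj_roots a b c x (galois_conj x)" using conj_roots_exist by blast
  then have "conj_roots a b c (galois_conj x) x" by (rule conj_roots_swap)
  from conj_roots_galois [OF this] show "quad_pt (p1_conj z)" "p1_conj (p1_conj z) = z"
    by (simp_all add: z)
qed

lemma quad_pt_mobius: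
  assumes "gl2 M" "quad_pt z"
  shows "quad_pt (mobius M z)" "p1_conj (mobius M z) = mobius M (p1_conj z)"
proof -
  obtain x where z: "z = Fin x" "quadratic_irrational x" using assms by (auto simp: quad_pt_def)
  then obtain a b c where r: "conj_roots a b c x (galois_conj x)" using conj_roots_exist by blast
  obtain x' y' a' b' c' where m: "mobius M (Fin x) = Fin x'" "mobius M (Fin (galois_conj x)) = Fin y'"
    "conj_roots a' b' c' x' y'" "b'\<^sup>2 - 4 * a' * c' = b\<^sup>2 - 4 * a * c"
    by (rule conj_roots_mobius [OF assms(1) r])
  show "quad_pt (mobius M z)" "p1_conj (mobius M z) = mobius M (p1_conj z)"
    using conj_roots_galois [OF m(3)] m by (simp_all add: z)
qed

text \<open>
  A fixed point of a matrix with lower row \<open>(s, t)\<close> and upper row \<open>(p, q)\<close> is a root of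
  \<open>s X\<^sup>2 + (t - p) X - q\<close>.
\<close>

lemma fixed_points_conjugate:
  assumes g: "gl2 M" and x: "\<not> ratpt x" "mobius M x = x" and nontrivial: "\<exists>z. mobius M z \<noteq> z"
    and y: "mobius M y = y"
  shows "quad_pt x" "y = x \<or> y = p1_conj x"
proof -
  obtain p q s t where M: "M = mat22 p q s t" by (rule mat22_cases)
  obtain r where r: "x = Fin r" "r \<notin> \<rat>" using x(1) by (rule not_ratptE)
  have ev: "mobius M (Fin z) = pt (of_int p * z + of_int q) (of_int s * z + of_int t)" for z
    using mobius_mat22_pt [of z 1 p q s t] by (simp add: M pt_def)
  have fix_eq: "of_int s * z\<^sup>2 + (of_int t - of_int p) * z - of_int q = 0"
    if "mobius M (Fin z) = Fin z" for z
    using that by (simp add: ev pt_def field_simps power2_eq_square split: if_splits)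
  have s: "s \<noteq> 0"
  proof
    assume s: "s = 0"
    then have e: "(of_int t - of_int p) * r = of_int q" using fix_eq x r by simp
    have "t = p"
    proof (rule ccontr)
      assume ne: "t \<noteq> p"
      then have "r = of_int q / (of_int t - of_int p)" using e by (simp add: field_simps)
      then show False using r by simp
    qed
    moreover from this have "q = 0" using e by simp
    moreover have "t \<noteq> 0" using g s by (auto simp: M gl2_def)
    ultimately have "mobius M z = z" for z
      by (cases z) (simp_all add: ev pt_def s, simp add: M s mobius.simps)
    then show False using nontrivial by blast
  qed
  define y' where "y' = (of_int p - of_int t) / of_int s - r"
  have cr: "conj_roots s (t - p) (- q) r y'"
    unfolding conj_roots_def
  proof (intro conjI)
    show "of_int s * (r + y') = - of_int (t - p)" using s by (simp add: y'_def)
    have "of_int s * (r * y') = (of_int p - of_int t) * r - of_int s * r\<^sup>2"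
      using s by (simp add: y'_def field_simps power2_eq_square)
    also have "\<dots> = - of_int q" using fix_eq [of r] x r by (simp add: algebra_simps)
    finally show "of_int s * (r * y') = of_int (- q)" by simp
  qed (use s r in auto)
  show "quad_pt x" using conj_roots_galois [OF cr] r by simp
  show "y = x \<or> y = p1_conj x"
  proof (cases y)
    case Infty
    have "mobius M Infty \<noteq> Infty" using s by (simp add: M mobius.simps)
    then show ?thesis using y Infty by simp
  next
    case (Fin v)
    have "of_int s * v\<^sup>2 + (of_int t - of_int p) * v - of_int q =
        (of_int s * r\<^sup>2 + (of_int t - of_int p) * r - of_int q) + of_int s * ((v - r) * (v - y'))"
      using s by (simp add: y'_def field_simps power2_eq_square)
    moreover have "of_int s * v\<^sup>2 + (of_int t - of_int p) * v - of_int q = 0"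
      "of_int s * r\<^sup>2 + (of_int t - of_int p) * r - of_int q = 0"
      using fix_eq x y r Fin by blast+
    ultimately have "real_of_int s * ((v - r) * (v - y')) = 0" by linarith
    then have "(v - r) * (v - y') = 0" using s by simp
    then show ?thesis using conj_roots_galois(2) [OF cr] r Fin by auto
  qed
qed

text \<open>
  If the roots have opposite signs then \<open>b\<^sup>2 - 4 a c\<close> is a sum of two nonnegative integers,
  so the discriminant bounds all coefficients.
\<close>

lemma finite_reduced_points:
  "finite {x. \<exists>a b c y. conj_roots a b c x y \<and> b\<^sup>2 - 4 * a * c = D \<and> x > 0 \<and> y < 0}"
proof (rule finite_subset)
  let ?root = "\<lambda>(a, b, c). {x. poly [:real_of_int c, of_int b, of_int a:] x = 0}"
  let ?box = "{(a, b, c). a \<noteq> 0 \<and> a \<in> {-D..D} \<and> b \<in> {-D..D} \<and> c \<in> {-D..D}}"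
  have "?box \<subseteq> {-D..D} \<times> {-D..D} \<times> {-D..D}" by auto
  then have "finite ?box" by (rule finite_subset) simp
  then show "finite (\<Union>t \<in> ?box. ?root t)"
    by (rule finite_UN_I) (auto intro!: poly_roots_finite simp del: poly_pCons)
  show "{x. \<exists>a b c y. conj_roots a b c x y \<and> b\<^sup>2 - 4 * a * c = D \<and> x > 0 \<and> y < 0} \<subseteq> (\<Union>t \<in> ?box. ?root t)"
  proof
    fix x :: real
    assume "x \<in> {x. \<exists>a b c y. conj_roots a b c x y \<and> b\<^sup>2 - 4 * a * c = D \<and> x > 0 \<and> y < 0}"
    then obtain a b c y
      where r: "conj_roots a b c x y" and D: "D = b\<^sup>2 - 4 * a * c" and xy: "x > 0" "y < 0" by blast
    have eqs: "of_int a * (x + y) = - of_int b" "of_int a * (x * y) = of_int c" and a: "a \<noteq> 0"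
      using r by (simp_all add: conj_roots_def)
    have "real_of_int (a * c) = of_int a * of_int a * (x * y)" by (simp add: eqs(2) [symmetric])
    also have "\<dots> < 0" using a xy by (intro mult_pos_neg) (auto simp: zero_less_mult_iff mult_pos_neg)
    finally have ac: "a * c < 0" by (simp only: of_int_less_0_iff)
    then have "\<bar>a * c\<bar> = - (a * c)" by simp
    then have abs: "\<bar>a\<bar> * \<bar>c\<bar> \<le> D" unfolding D using ac by (simp add: abs_mult [symmetric]) (smt (verit) zero_le_power2)
    have "a \<noteq> 0" "c \<noteq> 0" using ac by auto
    then have "\<bar>a\<bar> \<ge> 1" "\<bar>c\<bar> \<ge> 1" by linarith+
    then have "\<bar>a\<bar> \<le> \<bar>a\<bar> * \<bar>c\<bar>" "\<bar>c\<bar> \<le> \<bar>a\<bar> * \<bar>c\<bar>" by (simp_all add: mult_le_cancel_left1 mult_le_cancel_right1)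
    then have "\<bar>a\<bar> \<le> D" "\<bar>c\<bar> \<le> D" using abs by linarith+
    moreover have "\<bar>b\<bar> \<le> D"
    proof -
      have "\<bar>b\<bar> \<le> b\<^sup>2" using self_le_power [of "\<bar>b\<bar>" 2] by (cases "b = 0") auto
      then show ?thesis using ac D by linarith
    qed
    moreover have "poly [:real_of_int c, of_int b, of_int a:] x = 0"
    proof -
      have b: "real_of_int b = - (of_int a * (x + y))" using eqs by simp
      have "poly [:real_of_int c, of_int b, of_int a:] x = of_int c + x * (of_int b + x * of_int a)"
        by simp
      also have "\<dots> = 0" unfolding b eqs(2) [symmetric] by (simp add: algebra_simps)
      finally show ?thesis .
    qed
    ultimately show "x \<in> (\<Union>t \<in> ?box. ?root t)"
      using a by (intro UN_I [of "(a, b, c)"]) (auto simp: abs_le_iff)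
  qed
qed

section \<open>Orbits and paths\<close>

context cf_system
begin

definition prepend :: "edge \<Rightarrow> (nat \<Rightarrow> edge) \<Rightarrow> nat \<Rightarrow> edge" where
  "prepend e s = case_nat e s"

lemma prepend_simps [simp]: "prepend e s 0 = e" "prepend e s (Suc t) = s t"
  by (simp_all add: prepend_def)

lemma shift_prepend: "shift (Suc t) (prepend e s) = shift t s"
  by (simp add: shift_def fun_eq_iff)

lemma prepend_path:
  assumes "e \<in> A" "s \<in> paths A (tgt e)"
  shows "prepend e s \<in> paths A (src e)" "cf_point I (prepend e s) = mobius (Bmat I e) (cf_point I s)"
proof -
  show p: "prepend e s \<in> paths A (src e)"
    unfolding paths_def
  proof safe
    show "prepend e s t \<in> A" for t using assms by (cases t) (auto simp: paths_def)
    show "tgt (prepend e s t) = src (prepend e s (Suc t))" for t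
      using assms by (cases t) (auto simp: paths_def)
  qed simp
  show "cf_point I (prepend e s) = mobius (Bmat I e) (cf_point I s)"
    using cf_point_step [OF p] shift_prepend [of 0 e s] by simp
qed

text \<open>
  The multivalued map is defined through symbolic sequences and its dual through membership
  in the attractor; in the latter form the two can be compared.
\<close>

lemma calF_eq:
  "calF A I (i, x) = {(tgt a, mobius (matrix_inv (Bmat I a)) x) | a.
     a \<in> A \<and> src a = i \<and> mobius (matrix_inv (Bmat I a)) x \<in> H_set A I (tgt a)}"
proof -
  have "acts A I a (i, x) \<longleftrightarrow> src a = i \<and> mobius (matrix_inv (Bmat I a)) x \<in> H_set A I (tgt a)"
    if a: "a \<in> A" for a
  proof
    assume "acts A I a (i, x)"
    then obtain s where s: "s \<in> paths A i" "s 0 = a" "cf_point I s = x" by (auto simp: acts_def)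
    have "mobius (matrix_inv (Bmat I a)) x = cf_point I (shift 1 s)"
      using cf_point_step [OF s(1)] gl2_Bmat [OF a] s by (metis mobius_inv_left)
    moreover have "shift 1 s \<in> paths A (tgt a)"
      using paths_shift [OF s(1), of 1] paths_tgt [OF s(1), of 0] s by simp
    ultimately show "src a = i \<and> mobius (matrix_inv (Bmat I a)) x \<in> H_set A I (tgt a)"
      using paths_src [OF s(1)] s by (auto simp: H_set_def)
  next
    assume r: "src a = i \<and> mobius (matrix_inv (Bmat I a)) x \<in> H_set A I (tgt a)"
    then obtain s where s: "s \<in> paths A (tgt a)" "cf_point I s = mobius (matrix_inv (Bmat I a)) x"
      by (auto simp: H_set_def)
    then show "acts A I a (i, x)"
      using prepend_path [OF a s(1)] r gl2_Bmat [OF a] unfolding acts_def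
      by (intro bexI [of _ "prepend a s"]) auto
  qed
  then show ?thesis unfolding calF_def by (intro Collect_cong iff_exI) auto
qed

lemma path_orbit:
  assumes a: "a \<in> paths A i"
  shows "(\<lambda>t. cf_point I (shift t a)) \<in> orbits (Fmap n A I) (cf_point I a)"
proof -
  have "cf_point I (shift (Suc t) a) \<in> Fmap n A I (cf_point I (shift t a))" for t
  proof -
    have at: "a t \<in> A" by (rule paths_mem [OF a])
    have e: "cf_point I (shift (Suc t) a) = mobius (matrix_inv (Bmat I (a t))) (cf_point I (shift t a))"
      using cf_point_shift [OF a, of t] gl2_Bmat [OF at] by (metis mobius_inv_left)
    have H: "cf_point I (shift s a) \<in> H_set A I (src (a s))" for s
      using paths_shift [OF a] by (auto simp: H_set_def)
    have "mobius (matrix_inv (Bmat I (a t))) (cf_point I (shift t a)) \<in> H_set A I (tgt (a t))"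
      using H [of "Suc t"] paths_tgt [OF a, of t] e by simp
    then have "(tgt (a t), cf_point I (shift (Suc t) a)) \<in> calF A I (src (a t), cf_point I (shift t a))"
      unfolding calF_eq e using at by blast
    then have "cf_point I (shift (Suc t) a) \<in> snd ` calF A I (src (a t), cf_point I (shift t a))"
      by force
    then show ?thesis using H [of t] path_node [OF a, of t] by (auto simp: Fmap_def)
  qed
  then show ?thesis by (simp add: orbits_def del: shift_apply)
qed

text \<open>
  In a realization every image of a point is reached from each node that the point belongs to,
  so that successive edges can be chosen to fit together.
\<close>

lemma orbit_lift:
  assumes real: "realization n A I" and x: "x \<in> orbits (Fmap n A I) x0"
    and i: "i < n" "x0 \<in> H_set A I i"
  obtains a where "a \<in> paths A i" "\<forall>t. cf_point I (shift t a) = x t"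
proof -
  have step: "\<exists>e. e \<in> A \<and> src e = j \<and> x t = mobius (Bmat I e) (x (Suc t)) \<and> x (Suc t) \<in> H_set A I (tgt e)"
    if j: "j < n" "x t \<in> H_set A I j" for t j
  proof -
    have "x (Suc t) \<in> Fmap n A I (x t)" using x by (simp add: orbits_def)
    then obtain k where k: "k < n" "x t \<in> H_set A I k" "x (Suc t) \<in> snd ` calF A I (k, x t)"
      by (auto simp: Fmap_def)
    have "snd ` calF A I (k, x t) = snd ` calF A I (j, x t)"
      using real j k unfolding realization_def by blast
    then have "x (Suc t) \<in> snd ` calF A I (j, x t)" using k by simp
    then obtain e where "e \<in> A" "src e = j" "x (Suc t) = mobius (matrix_inv (Bmat I e)) (x t)"
        "x (Suc t) \<in> H_set A I (tgt e)"
      by (auto simp: calF_eq)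
    moreover from this have "x t = mobius (Bmat I e) (x (Suc t))" by (simp add: gl2_Bmat)
    ultimately show ?thesis by blast
  qed
  \<comment> \<open>the edge to take at time \<open>t\<close> from node \<open>j\<close>\<close>
  define e where "e t j = (SOME e. e \<in> A \<and> src e = j \<and> x t = mobius (Bmat I e) (x (Suc t)) \<and>
    x (Suc t) \<in> H_set A I (tgt e))" for t j
  have e: "e t j \<in> A \<and> src (e t j) = j \<and> x t = mobius (Bmat I (e t j)) (x (Suc t)) \<and>
      x (Suc t) \<in> H_set A I (tgt (e t j))" if "j < n" "x t \<in> H_set A I j" for t j
    unfolding e_def by (rule someI_ex) (rule step [OF that])
  define node where "node = rec_nat i (\<lambda>t j. tgt (e t j))"
  have node_simps: "node 0 = i" "node (Suc t) = tgt (e t (node t))" for t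
    by (simp_all add: node_def)
  have node: "node t < n \<and> x t \<in> H_set A I (node t)" for t
  proof (induction t)
    case 0
    then show ?case using x i by (simp add: node_simps orbits_def)
  next
    case (Suc t)
    then show ?case using e [of "node t" t] edge_nodes by (simp add: node_simps)
  qed
  define a where "a t = e t (node t)" for t
  have a: "a t \<in> A" "src (a t) = node t" "x t = mobius (Bmat I (a t)) (x (Suc t))"
      "tgt (a t) = node (Suc t)" for t
    using e [of "node t" t] node [of t] by (auto simp: a_def node_simps)
  have path: "a \<in> paths A i" by (simp add: paths_def a node_simps(1))
  show ?thesis
  proof (rule that [OF path], rule allI)
    fix t
    have "cf_point I (shift t a) = x (t + 0)"
    proof (rule cf_point_eqI [OF paths_shift [OF path]])
      fix s
      show "x (t + s) = mobius (Bmat I (shift t a s)) (x (t + Suc s))" using a(3) [of "t + s"] by simp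
      have "x (t + s) \<in> H_set A I (node (t + s))" using node by blast
      then show "x (t + s) \<in> interval (I (src (shift t a s)))"
        using cf_point_interval by (auto simp: H_set_def a(2))
    qed
    then show "cf_point I (shift t a) = x t" by simp
  qed
qed

text \<open>
  Along a lift of a periodic orbit some node recurs at two multiples of the period, and then
  the lift is periodic from the first of them on.
\<close>

lemma periodic_orbit_lift:
  assumes real: "realization n A I" and x: "x \<in> orbits (Fmap n A I) x0"
    and p: "has_period p x" and irr: "\<not> ratpt x0"
  obtains i a q where "i < n" "a \<in> paths A i" "has_period q a" "\<forall>t. cf_point I (shift t a) = x t"
proof -
  have x0: "x 0 = x0" "x (Suc 0) \<in> Fmap n A I x0" using x by (auto simp: orbits_def)
  then obtain i where i: "i < n" "x0 \<in> H_set A I i" by (auto simp: Fmap_def)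
  obtain a where a: "a \<in> paths A i" "\<forall>t. cf_point I (shift t a) = x t"
    by (rule orbit_lift [OF real x i])
  have p1: "p \<ge> 1" using p by (simp add: has_period_def)
  have "(\<lambda>k. src (a (k * p))) ` UNIV \<subseteq> {..<n}" using path_node [OF a(1)] by auto
  then have "\<not> inj (\<lambda>k. src (a (k * p)))"
    using finite_imageD finite_subset infinite_UNIV_nat by (metis finite_lessThan)
  then obtain k l where kl: "k < l" "src (a (k * p)) = src (a (l * p))"
    unfolding inj_def by (metis linorder_less_linear)
  have per: "x (k * p + t) = x t" for k t
    using has_period_mod [OF p, of "k * p + t"] has_period_mod [OF p, of t] by simp
  let ?c = "shift (k * p) a" and ?q = "(l - k) * p"
  have lk: "k * p + ?q = l * p" using kl by (simp add: diff_mult_distrib)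
  have c: "?c \<in> paths A (src (a (k * p)))" by (rule paths_shift [OF a(1)])
  have pts: "cf_point I (shift t ?c) = x t" for t using a(2) per by simp
  have "has_period ?q ?c"
  proof (rule recurrence_forces_period [OF c])
    show "?q \<ge> 1" using kl p1 by simp
    show "src (?c ?q) = src (a (k * p))" using kl lk by simp
    show "cf_point I (shift ?q ?c) = cf_point I ?c" using pts [of ?q] pts [of 0] per [of "l - k" 0] by simp
    show "\<not> ratpt (cf_point I ?c)" using pts [of 0] irr x0 by simp
  qed
  then show ?thesis using that [OF path_node [OF a(1)] c] pts by blast
qed

end

section \<open>The dual continued fraction\<close>

lemma edge_sharp_simps [simp]:
  "src (edge_sharp a) = tgt a" "tgt (edge_sharp a) = src a" "lab (edge_sharp a) = sg_sharp (lab a)"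
  "edge_sharp (edge_sharp a) = a"
  by (simp_all add: edge_sharp_def src_def tgt_def lab_def sg_sharp_sharp)

lemma walk_sharp: "walk j (map edge_sharp (rev as)) i \<longleftrightarrow> walk i as j"
  by (induction as arbitrary: i) (auto simp: walk_append)

lemma label_sharp: "label (map edge_sharp (rev as)) = sg_sharp (label as)"
  by (induction as) (simp_all add: sg_sharp_mult, simp add: one_sg_def)

lemma is_code_sharp:
  assumes "is_code n A" shows "is_code n (edge_sharp ` A)"
  unfolding is_code_def
proof (intro conjI allI impI)
  show "edge_sharp ` A \<subseteq> Sigma_tilde n" using assms by (auto simp: is_code_def Sigma_tilde_def)
next
  fix as bs c
  assume sub: "set as \<subseteq> edge_sharp ` A" "set bs \<subseteq> edge_sharp ` A"
    and prod: "edge_prod as = Some c" "edge_prod bs = Some c"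
  have ne: "as \<noteq> []" "bs \<noteq> []" using prod by auto
  let ?r = "\<lambda>as. map edge_sharp (rev as)"
  have "?r as = ?r bs"
  proof (rule code_walk_unique [OF assms])
    show "set (?r as) \<subseteq> A" "set (?r bs) \<subseteq> A" using sub by auto
    show "walk (tgt c) (?r as) (src c)" "walk (tgt c) (?r bs) (src c)"
      using prod ne by (simp_all add: edge_prod_walk walk_sharp)
    show "label (?r as) = label (?r bs)" using prod ne by (simp add: edge_prod_walk label_sharp)
  qed (use ne in auto)
  moreover have "inj edge_sharp" by (metis edge_sharp_simps(4) injI)
  ultimately have "rev as = rev bs" by (metis inj_map_eq_map)
  then show "as = bs" by simp
qed

lemma sg_generator_induct:
  assumes "P 1" "P sg_l" "P sg_n" "P sg_f" "\<And>a b. P a \<Longrightarrow> P b \<Longrightarrow> P (a * b)"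
  shows "P s"
proof (cases s)
  case (Sg w e)
  have letter: "P (Sg [q] False)" for q
    using assms by (cases q) (simp_all add: sg_l_def sg_n_def)
  have "P (Sg w e)"
  proof (induction w)
    case Nil
    then show ?case using assms by (cases e) (simp_all add: sg_f_def one_sg_def)
  next
    case (Cons q w)
    have "Sg (q # w) e = Sg [q] False * Sg w e" by simp
    then show ?case using assms(5) letter Cons by metis
  qed
  then show ?thesis by (simp add: Sg)
qed

text \<open>
  Up to sign, conjugation by \<open>S0\<close> turns the matrix of a word into the inverse of the matrix
  of the dual word.
\<close>

lemma proj_sharp:
  "mobius (proj s) (mobius S0 (mobius (proj (sg_sharp s)) x)) = mobius S0 x"
proof (induction s arbitrary: x rule: sg_generator_induct)
  case 1
  have "sg_sharp 1 = 1" by (simp add: one_sg_def)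
  then show ?case by (simp add: proj_one)
next
  case 2
  have "mat22 1 0 1 1 ** (S0 ** mat22 1 1 0 1) = S0" by (simp add: S0_def mat22_mult)
  moreover have "gl2 (mat22 1 1 0 1)" by (simp add: gl2_def)
  ultimately show ?case
    unfolding sg_sharp_generators proj_generators by (metis mobius_mult gl2_S0 gl2_mult)
next
  case 3
  have "mat22 1 1 0 1 ** (S0 ** mat22 1 0 1 1) = S0" by (simp add: S0_def mat22_mult)
  moreover have "gl2 (mat22 1 0 1 1)" by (simp add: gl2_def)
  ultimately show ?case
    unfolding sg_sharp_generators proj_generators by (metis mobius_mult gl2_S0 gl2_mult)
next
  case 4
  have "- S0 = mat22 0 1 (-1) 0"
    by (simp add: S0_def Finite_Cartesian_Product.vec_eq_iff forall_2)
  then have "mat22 0 1 1 0 ** (S0 ** mat22 0 1 1 0) = - S0" by (simp add: S0_def mat22_mult)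
  moreover have "gl2 (mat22 0 1 1 0)" by (simp add: gl2_def)
  ultimately show ?case
    unfolding sg_sharp_generators proj_generators by (metis mobius_mult gl2_S0 gl2_mult mobius_uminus)
next
  case (5 a b)
  then show ?case by (simp add: sg_sharp_mult proj_mult mobius_mult gl2_proj)
qed

text \<open>The interval of \<open>M\<close> and its complement have only the two rational endpoints in common.\<close>

lemma complementary_intervals:
  assumes "gl2 M" "x \<in> interval M" "x \<in> interval (M ** S0)"
  shows "ratpt x"
proof -
  obtain y where y: "y \<in> nonneg" "x = mobius M y" using assms(2) by (auto simp: interval_nonneg)
  obtain z where z: "z \<in> nonneg" "x = mobius (M ** S0) z" using assms(3) by (auto simp: interval_nonneg)
  have yz: "y = mobius S0 z"
    using y z inj_mobius [OF assms(1)] by (auto simp: mobius_mult gl2_S0 dest: injD)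
  obtain u v where uv: "z = pt u v" "u \<ge> 0" "v \<ge> 0" "u + v > 0" using z(1) by (rule nonnegE)
  obtain u' v' where uv': "y = pt u' v'" "u' \<ge> 0" "v' \<ge> 0" "u' + v' > 0" using y(1) by (rule nonnegE)
  have nz: "u \<noteq> 0 \<or> v \<noteq> 0" "u' \<noteq> 0 \<or> v' \<noteq> 0" using uv uv' by auto
  have "mobius S0 z = pt (- v) u" using nz uv by (simp add: S0_def mobius_mat22_pt)
  then have "pt u' v' = pt (- v) u" using yz uv' by simp
  then have "u' * u = - v * v'" using nz by (subst (asm) pt_eq_iff) auto
  moreover have "u' * u \<ge> 0" "v * v' \<ge> 0" using uv uv' by simp_all
  ultimately have "u' * u = 0" "v * v' = 0" by linarith+
  then have "u' = 0 \<or> v' = 0" using nz by auto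
  then have "y = Fin 0 \<or> y = Infty" using uv' by (auto simp: pt_def)
  then have "ratpt y" by (auto simp: ratpt_Fin ratpt_Infty)
  then show ?thesis using y assms(1) by simp
qed

lemma rev_paths_sharp:
  "b \<in> rev_paths A i \<longleftrightarrow> edge_sharp \<circ> b \<in> paths (edge_sharp ` A) i"
proof -
  have "edge_sharp e \<in> edge_sharp ` A \<longleftrightarrow> e \<in> A" for e by (metis edge_sharp_simps(4) image_iff)
  then show ?thesis by (simp add: rev_paths_def paths_def)
qed

lemma rev_paths_shift: "b \<in> rev_paths A i \<Longrightarrow> shift k b \<in> rev_paths A (tgt (b k))"
  by (simp add: rev_paths_def)

lemma reflect_paths:
  assumes a: "a \<in> paths A i" and q: "has_period q a"
  shows "reflect (-1) q a \<in> rev_paths A i"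
  unfolding rev_paths_def
proof safe
  have tgt: "tgt (a (nat (z mod int q))) = src (a (nat ((z + 1) mod int q)))" for z
    using paths_tgt [OF a] has_period_Suc_mod [OF q] by simp
  show "reflect (-1) q a t \<in> A" for t using paths_mem [OF a] by (simp add: reflect_def)
  show "tgt (reflect (-1) q a 0) = i" using tgt [of "-1"] paths_src [OF a] by (simp add: reflect_def)
  show "src (reflect (-1) q a t) = tgt (reflect (-1) q a (Suc t))" for t
    using tgt [of "-1 - int (Suc t)"] by (simp add: reflect_def)
qed

lemma reflect_rev_paths:
  assumes b: "b \<in> rev_paths A i" and q: "has_period q b"
  shows "reflect (-1) q b \<in> paths A i"
  unfolding paths_def
proof safe
  have src: "src (b (nat (z mod int q))) = tgt (b (nat ((z + 1) mod int q)))" for z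
    using b has_period_Suc_mod [OF q] by (simp add: rev_paths_def)
  show "reflect (-1) q b t \<in> A" for t using b by (simp add: reflect_def rev_paths_def)
  show "src (reflect (-1) q b 0) = i" using src [of "-1"] b by (simp add: reflect_def rev_paths_def)
  show "tgt (reflect (-1) q b t) = src (reflect (-1) q b (Suc t))" for t
    using src [of "-1 - int (Suc t)"] by (simp add: reflect_def)
qed

context cf_system
begin

lemma dual_system: "cf_system n (edge_sharp ` A) (\<lambda>i. I i ** S0)"
  by unfold_locales (simp_all add: is_code_sharp code gl2_mult gl2_I gl2_S0)

interpretation dual: cf_system n "edge_sharp ` A" "\<lambda>i. I i ** S0"
  by (rule dual_system)

text \<open>The maps of the dual continued fraction are the inverses \<open>Dmat\<close> of the maps of the original one.\<close>

lemma Bmat_sharp: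
  assumes a: "a \<in> A"
  shows "mobius (Bmat I a) (mobius (Bmat (\<lambda>i. I i ** S0) (edge_sharp a)) x) = x"
proof -
  have g: "gl2 (I (src a))" "gl2 (I (tgt a))" using gl2_I edge_nodes [OF a] by auto
  define y where "y = mobius (matrix_inv (I (src a) ** S0)) x"
  have x: "x = mobius (I (src a) ** S0) y" using g by (simp add: y_def gl2_mult gl2_S0)
  have "mobius (Bmat I a) (mobius (Bmat (\<lambda>i. I i ** S0) (edge_sharp a)) x) =
      mobius (I (src a)) (mobius (proj (lab a)) (mobius S0 (mobius (proj (sg_sharp (lab a))) y)))"
    using g by (simp add: Bmat_def mobius_mult gl2_mult gl2_proj gl2_matrix_inv gl2_S0 y_def)
  also have "\<dots> = x" using g by (simp add: proj_sharp x mobius_mult gl2_S0)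
  finally show ?thesis .
qed

lemma Dmat_sharp:
  assumes a: "a \<in> A"
  shows "mobius (Dmat I a) x = mobius (Bmat (\<lambda>i. I i ** S0) (edge_sharp a)) x"
    "mobius (matrix_inv (Dmat I a)) x = mobius (Bmat I a) x"
    "mobius (matrix_inv (Bmat (\<lambda>i. I i ** S0) (edge_sharp a))) x = mobius (Bmat I a) x"
proof -
  have g: "gl2 (Bmat I a)" "gl2 (Bmat (\<lambda>i. I i ** S0) (edge_sharp a))"
    using a by (simp_all add: gl2_Bmat dual.gl2_Bmat)
  show "mobius (Dmat I a) x = mobius (Bmat (\<lambda>i. I i ** S0) (edge_sharp a)) x"
    using Bmat_sharp [OF a, of x] g by (metis Dmat_def mobius_inv_left)
  show "mobius (matrix_inv (Dmat I a)) x = mobius (Bmat I a) x"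
    using g by (metis Dmat_def gl2_matrix_inv mobius_inv_left mobius_inv_right)
  show "mobius (matrix_inv (Bmat (\<lambda>i. I i ** S0) (edge_sharp a))) x = mobius (Bmat I a) x"
    using Bmat_sharp [OF a] g by (metis mobius_inv_right)
qed

lemma cf_point_dual_sharp:
  assumes b: "b \<in> rev_paths A i"
  shows "cf_point_dual I b = cf_point (\<lambda>i. I i ** S0) (edge_sharp \<circ> b)"
proof -
  have mem: "b t \<in> A" for t using b by (simp add: rev_paths_def)
  have b': "edge_sharp \<circ> b \<in> paths (edge_sharp ` A) i" using b rev_paths_sharp by blast
  have "mobius (seq_prod (Dmat I) b t) x = mobius (seq_prod (Bmat (\<lambda>i. I i ** S0)) (edge_sharp \<circ> b) t) x" for t x
  proof (induction t arbitrary: x)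
    case (Suc t)
    have "gl2 (Dmat I (b t))" by (simp add: Dmat_def gl2_matrix_inv gl2_Bmat mem)
    moreover have "gl2 (Bmat (\<lambda>i. I i ** S0) (edge_sharp (b t)))" by (simp add: dual.gl2_Bmat mem)
    ultimately show ?case using Suc Dmat_sharp(1) [OF mem] by (simp add: mobius_mult)
  qed simp
  then show ?thesis by (simp add: cf_point_dual_def cf_point_def)
qed

lemma K_set_sharp: "K_set A I i = H_set (edge_sharp ` A) (\<lambda>i. I i ** S0) i"
proof -
  have "paths (edge_sharp ` A) i = (\<lambda>b. edge_sharp \<circ> b) ` rev_paths A i"
  proof
    show "(\<lambda>b. edge_sharp \<circ> b) ` rev_paths A i \<subseteq> paths (edge_sharp ` A) i"
      using rev_paths_sharp by blast
    show "paths (edge_sharp ` A) i \<subseteq> (\<lambda>b. edge_sharp \<circ> b) ` rev_paths A i"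
    proof
      fix c assume c: "c \<in> paths (edge_sharp ` A) i"
      have "c = edge_sharp \<circ> (edge_sharp \<circ> c)" by (simp add: fun_eq_iff)
      then show "c \<in> (\<lambda>b. edge_sharp \<circ> b) ` rev_paths A i" using c rev_paths_sharp by (metis imageI)
    qed
  qed
  then show ?thesis
    unfolding K_set_def H_set_def by (auto simp: image_image cf_point_dual_sharp intro!: image_cong)
qed

lemma cf_point_dual_interval:
  assumes "b \<in> rev_paths A i" shows "cf_point_dual I b \<in> interval (I i ** S0)"
  using assms dual.cf_point_interval rev_paths_sharp cf_point_dual_sharp by metis

lemma cf_point_dual_shift:
  assumes b: "b \<in> rev_paths A i"
  shows "cf_point_dual I (shift (Suc t) b) = mobius (Bmat I (b t)) (cf_point_dual I (shift t b))"
proof -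
  have mem: "b t \<in> A" using b by (simp add: rev_paths_def)
  have b': "edge_sharp \<circ> b \<in> paths (edge_sharp ` A) i" using b rev_paths_sharp by blast
  have "cf_point_dual I (shift t b) =
      mobius (Bmat (\<lambda>i. I i ** S0) (edge_sharp (b t))) (cf_point_dual I (shift (Suc t) b))"
    using dual.cf_point_shift [OF b', of t]
    unfolding shift_comp cf_point_dual_sharp [OF rev_paths_shift [OF b]] by simp
  then show ?thesis using Bmat_sharp [OF mem] by simp
qed

lemma calF_dual_eq: "calF_dual A I (i, y) = calF (edge_sharp ` A) (\<lambda>i. I i ** S0) (i, y)"
proof -
  let ?S = "{(src a, mobius (Bmat I a) y) | a.
      a \<in> A \<and> tgt a = i \<and> mobius (Bmat I a) y \<in> K_set A I (src a)}"
  have "calF_dual A I (i, y) = ?S"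
    unfolding calF_dual_def by (intro Collect_cong iff_exI) (auto simp: Dmat_sharp)
  also have "?S = {(tgt (edge_sharp a), mobius (matrix_inv (Bmat (\<lambda>i. I i ** S0) (edge_sharp a))) y) | a.
      a \<in> A \<and> src (edge_sharp a) = i \<and>
      mobius (matrix_inv (Bmat (\<lambda>i. I i ** S0) (edge_sharp a))) y
        \<in> H_set (edge_sharp ` A) (\<lambda>i. I i ** S0) (tgt (edge_sharp a))}"
    by (intro Collect_cong iff_exI) (auto simp: Dmat_sharp K_set_sharp)
  also have "\<dots> = calF (edge_sharp ` A) (\<lambda>i. I i ** S0) (i, y)"
    unfolding dual.calF_eq by blast
  finally show ?thesis .
qed

lemma Fmap_dual_eq: "Fmap_dual n A I = Fmap n (edge_sharp ` A) (\<lambda>i. I i ** S0)"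
  by (simp add: fun_eq_iff Fmap_dual_def Fmap_def K_set_sharp calF_dual_eq)

section \<open>Reversed loops and Galois conjugation\<close>

text \<open>
  Otherwise the cylinder of the label would be the whole interval from 0 to \<open>\<infinity>\<close>, whereas its
  width is at most 1/2.
\<close>

lemma loop_moves_point:
  assumes a: "a \<in> paths A i" and q: "q \<ge> 1" "src (a q) = i"
  shows "\<exists>z. mobius (seq_prod (Bmat I) a q) z \<noteq> z"
proof (rule ccontr)
  assume "\<not> ?thesis"
  then have triv: "mobius (seq_prod (Bmat I) a q) z = z" for z by blast
  have g: "gl2 (I i)" using gl2_I path_start [OF a] by blast
  have "mobius (I i) (mobius (proj (path_label a q)) z) = mobius (I i) z" for z
    using seq_prod_I [OF a, of q] triv [of "mobius (I i) z"] g q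
    by (simp add: gl2_proj flip: mobius_mult)
  then have "mobius (proj (path_label a q)) z = z" for z using g by (metis mobius_inv_left)
  then have "cylinder (sg_word (path_label a q)) = nonneg" by (simp flip: proj_nonneg)
  then have "\<bar>coord Infty - coord (Fin 0)\<bar> \<le> 1 / (1 + real (sg_len (path_label a q)))"
    unfolding sg_len_def by (intro cylinder_width) (auto simp: nonneg_def)
  then show False using code_path_loop_pos [OF code a q(2,1)] by (simp add: field_simps)
qed

text \<open>
  The point of a loop and the point of the reversed loop are fixed by the same matrix, and
  they lie in complementary intervals.
\<close>

lemma reversed_loop_conjugate:
  assumes a: "a \<in> paths A i" and q: "has_period q a"
  defines "x \<equiv> cf_point I a" and "y \<equiv> cf_point_dual I (reflect (-1) q a)"
  shows "\<not> ratpt x \<Longrightarrow> quad_pt x \<and> y = p1_conj x"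
    and "\<not> ratpt y \<Longrightarrow> quad_pt y \<and> x = p1_conj y"
proof -
  define b where "b = reflect (-1) q a"
  have b: "b \<in> rev_paths A i" unfolding b_def by (rule reflect_paths [OF a q])
  have q1: "q \<ge> 1" using q by (simp add: has_period_def)
  have src: "src (a q) = i" using fun_cong [OF has_period_shift [OF q, of 1], of 0] paths_src [OF a] by simp
  let ?M = "seq_prod (Bmat I) a q"
  have g: "gl2 (I i)" "gl2 ?M" using gl2_I path_start [OF a] gl2_seq_prod [OF a] by auto
  \<comment> \<open>the matrices of the loop, in the order of \<open>a\<close>, carry the points of the reversed loop around\<close>
  define z where "z t = cf_point_dual I (shift t b)" for t
  have "shift q b = b"
    using has_period_shift [OF reflect_has_period [OF q q], of 1 "-1"] by (simp add: b_def)
  then have zq: "z q = z 0" by (simp add: z_def)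
  have "mobius (seq_prod (Bmat I) a t) (z (q - t)) = z q" if "t \<le> q" for t
    using that
  proof (induction t)
    case (Suc t)
    have "(- 1 - int (q - Suc t)) mod int q = (int t + (- 1) * int q) mod int q"
      using Suc.prems by (simp add: of_nat_diff)
    also have "\<dots> = int t" using Suc.prems by (subst mod_mult_self1) simp
    finally have "b (q - Suc t) = a t" by (simp add: b_def reflect_def)
    moreover have "Suc (q - Suc t) = q - t" using Suc.prems by simp
    ultimately have "z (q - t) = mobius (Bmat I (a t)) (z (q - Suc t))"
      using cf_point_dual_shift [OF b, of "q - Suc t"] by (simp add: z_def)
    then show ?case using Suc by (simp add: mobius_mult gl2_Bmat paths_mem [OF a])
  qed simp
  from this [of q] have fy: "mobius ?M y = y" using zq by (simp add: z_def y_def b_def)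
  have fx: "mobius ?M x = x" unfolding x_def by (rule period_fixes_point [OF a q])
  have moves: "\<exists>z. mobius ?M z \<noteq> z" by (rule loop_moves_point [OF a q1 src])
  have "x \<in> interval (I i)" unfolding x_def by (rule cf_point_interval [OF a])
  moreover have "y \<in> interval (I i ** S0)" unfolding y_def b_def [symmetric] by (rule cf_point_dual_interval [OF b])
  ultimately have ne: "ratpt x" if "x = y" using complementary_intervals [OF g(1)] that by blast
  show "quad_pt x \<and> y = p1_conj x" if "\<not> ratpt x"
    using fixed_points_conjugate [OF g(2) that fx moves fy] ne that by blast
  show "quad_pt y \<and> x = p1_conj y" if "\<not> ratpt y"
    using fixed_points_conjugate [OF g(2) that fy moves fx] ne that by auto
qed

section \<open>Periodicity of reduced points\<close>

definition has_disc :: "int \<Rightarrow> p1 \<Rightarrow> bool" where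
  "has_disc D z \<longleftrightarrow> (\<exists>a b c x y. z = Fin x \<and> conj_roots a b c x y \<and> b\<^sup>2 - 4 * a * c = D)"

lemma has_disc_mobius: assumes g: "gl2 M" and z: "has_disc D z" shows "has_disc D (mobius M z)"
proof -
  obtain a b c x y where r: "z = Fin x" "conj_roots a b c x y" "b\<^sup>2 - 4 * a * c = D"
    using z by (auto simp: has_disc_def)
  obtain x' y' a' b' c' where m: "mobius M (Fin x) = Fin x'" "mobius M (Fin y) = Fin y'"
    "conj_roots a' b' c' x' y'" "b'\<^sup>2 - 4 * a' * c' = b\<^sup>2 - 4 * a * c"
    by (rule conj_roots_mobius [OF g r(2)])
  then show ?thesis using r unfolding has_disc_def by metis
qed

text \<open>
  Going backwards along \<open>b\<close> from the point of \<open>a\<close> one meets pairs of conjugate points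
  which are separated by the interval of the current node and have a fixed discriminant.  There are
  finitely many, so that a pair recurs at the same node, which makes the expansion periodic.
\<close>

lemma reduced_point_periodic:
  assumes a: "a \<in> paths A i" and b: "b \<in> rev_paths A i"
    and quad: "quad_pt (cf_point I a)" and conj: "cf_point_dual I b = p1_conj (cf_point I a)"
  shows "purely_periodic a"
proof -
  \<comment> \<open>\<open>s t\<close> is the path \<open>a\<close>, extended backwards by \<open>t\<close> steps along \<open>b\<close>\<close>
  define s where "s = rec_nat a (\<lambda>t. prepend (b t))"
  have s_simps: "s 0 = a" "s (Suc t) = prepend (b t) (s t)" for t by (simp_all add: s_def)
  define nd where "nd t = tgt (b t)" for t
  have bA: "b t \<in> A" for t using b by (simp add: rev_paths_def)
  have nd: "nd 0 = i" "nd (Suc t) = src (b t)" "nd t < n" for t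
    using b bA edge_nodes by (auto simp: nd_def rev_paths_def)
  have s: "s t \<in> paths A (nd t)" for t
  proof (induction t)
    case 0
    then show ?case using a by (simp add: s_simps nd)
  next
    case (Suc t)
    then show ?case using prepend_path(1) [OF bA, of "s t" t] by (simp add: s_simps nd(2)) (simp add: nd_def)
  qed
  define z where "z t = cf_point I (s t)" for t
  have z: "z (Suc t) = mobius (Bmat I (b t)) (z t)" for t
    using prepend_path(2) [OF bA, of "s t" t] s [of t] by (simp add: z_def s_simps nd_def)
  have zq: "quad_pt (z t) \<and> cf_point_dual I (shift t b) = p1_conj (z t)" for t
  proof (induction t)
    case 0
    then show ?case using quad conj by (simp add: z_def s_simps)
  next
    case (Suc t)
    then show ?case using quad_pt_mobius [OF gl2_Bmat [OF bA]] cf_point_dual_shift [OF b]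
      by (simp add: z del: shift_apply)
  qed
  obtain D where D0: "has_disc D (z 0)"
  proof -
    obtain x where x: "z 0 = Fin x" "quadratic_irrational x"
      using quad by (auto simp: z_def s_simps quad_pt_def)
    obtain k l m where "conj_roots k l m x (galois_conj x)" using x(2) by (rule conj_roots_exist)
    then have "has_disc (l\<^sup>2 - 4 * k * m) (z 0)" using x(1) unfolding has_disc_def by blast
    then show ?thesis by (rule that)
  qed
  have D: "has_disc D (z t)" for t
    by (induction t) (simp_all add: D0 z has_disc_mobius gl2_Bmat bA)
  \<comment> \<open>normalized so that the interval of the node becomes the interval from 0 to \<open>\<infinity>\<close>, and being separated
    means having opposite signs\<close>
  define \<xi> where "\<xi> t = mobius (matrix_inv (I (nd t))) (z t)" for t
  have g: "gl2 (I (nd t))" for t using gl2_I nd by blast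
  let ?red = "{x. \<exists>a b c y. conj_roots a b c x y \<and> b\<^sup>2 - 4 * a * c = D \<and> x > 0 \<and> y < 0}"
  have red: "\<xi> t \<in> Fin ` ?red" for t
  proof -
    have "has_disc D (\<xi> t)" unfolding \<xi>_def by (intro has_disc_mobius D gl2_matrix_inv g)
    then obtain k l m x y where r: "\<xi> t = Fin x" "conj_roots k l m x y" "l\<^sup>2 - 4 * k * m = D"
      by (auto simp: has_disc_def)
    have y: "galois_conj x = y" by (rule conj_roots_galois(2) [OF r(2)])
    have irr: "x \<notin> \<rat>" "y \<notin> \<rat>"
      using r(2) conj_roots_swap [OF r(2)] by (simp_all add: conj_roots_def)
    have "z t \<in> interval (I (nd t))" unfolding z_def by (rule cf_point_interval [OF s])
    then have "Fin x \<in> nonneg" using g r(1) by (auto simp: \<xi>_def interval_nonneg)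
    then have "x \<ge> 0" by (auto simp: nonneg_def)
    moreover have "x \<noteq> 0" using irr by auto
    moreover have "y < 0"
    proof (rule ccontr)
      assume "\<not> y < 0"
      then have "Fin y \<in> nonneg" by (simp add: nonneg_def)
      moreover have "Fin y = p1_conj (\<xi> t)" by (simp add: r y)
      then have "Fin y = mobius (matrix_inv (I (nd t))) (cf_point_dual I (shift t b))"
        using quad_pt_mobius [OF gl2_matrix_inv [OF g], of "z t" t] zq [of t] by (simp add: \<xi>_def)
      then have e: "mobius (I (nd t)) (Fin y) = cf_point_dual I (shift t b)" using g by simp
      ultimately have "cf_point_dual I (shift t b) \<in> interval (I (nd t))"
        by (metis imageI interval_nonneg)
      moreover have "cf_point_dual I (shift t b) \<in> interval (I (nd t) ** S0)"
        unfolding nd_def by (rule cf_point_dual_interval [OF rev_paths_shift [OF b]])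
      ultimately have "ratpt (mobius (I (nd t)) (Fin y))" unfolding e by (rule complementary_intervals [OF g])
      then show False using g irr by (simp add: ratpt_Fin)
    qed
    ultimately have "x \<in> ?red" using r by (intro CollectI exI [of _ k] exI [of _ l] exI [of _ m] exI [of _ y]) auto
    then show ?thesis using r by simp
  qed
  have "(\<lambda>t. (nd t, \<xi> t)) ` UNIV \<subseteq> {..<n} \<times> Fin ` ?red" using red nd by auto
  then have "finite ((\<lambda>t. (nd t, \<xi> t)) ` UNIV)"
    by (rule finite_subset) (intro finite_cartesian_product finite_imageI finite_reduced_points finite_lessThan)
  then have "\<not> inj (\<lambda>t. (nd t, \<xi> t))" using finite_imageD infinite_UNIV_nat by blast
  then obtain u t where ut: "u < t" "nd u = nd t" "\<xi> u = \<xi> t"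
    unfolding inj_def by (metis linorder_less_linear prod.inject)
  have "z r = mobius (I (nd r)) (\<xi> r)" for r using g by (simp add: \<xi>_def)
  then have zz: "z u = z t" using ut by simp
  have sh: "shift m (s (m + r)) = s r" for m r
  proof (induction m)
    case (Suc m)
    then show ?case by (simp add: s_simps shift_prepend)
  qed simp
  define q where "q = t - u"
  have st: "shift q (s t) = s u" using sh [of q u] ut by (simp add: q_def)
  have per: "has_period q (s t)"
  proof (rule recurrence_forces_period [OF s])
    show "q \<ge> 1" using ut by (simp add: q_def)
    have "src (s t q) = src (shift q (s t) 0)" by simp
    then show "src (s t q) = nd t" using st paths_src [OF s [of u]] ut by simp
    show "cf_point I (shift q (s t)) = cf_point I (s t)" using st zz by (simp add: z_def)
    show "\<not> ratpt (cf_point I (s t))" using zq [of t] quad_pt_not_ratpt by (simp add: z_def)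
  qed
  have "a = shift t (s t)" using sh [of t 0] by (simp add: s_simps)
  then have "has_period q a" using per by (simp add: has_period_def flip: add.assoc)
  then show ?thesis by (auto simp: purely_periodic_iff)
qed

end

section \<open>Purely periodic orbits\<close>

lemma symbolic_periods_image:
  "symbolic_periods S = (\<lambda>a. map a [0..<period a]) ` {a \<in> S. purely_periodic a}"
  unfolding symbolic_periods_def by blast

context cf_system
begin

lemma path_orbit_periodic:
  assumes "has_period q a"
  shows "has_period q (\<lambda>t. cf_point I (shift t a))"
proof -
  have "a ((t + s) + q) = a (t + s)" for s t using assms by (simp add: has_period_def)
  then have "a (t + q + s) = a (t + s)" for s t by (metis add.assoc add.commute)
  then have "shift (t + q) a = shift t a" for t by (simp add: fun_eq_iff)
  then show ?thesis using assms by (simp add: has_period_def del: shift_apply)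
qed

end

context cf_system
begin

interpretation dual: cf_system n "edge_sharp ` A" "\<lambda>i. I i ** S0"
  by (rule dual_system)

text \<open>Every orbit lifts to a path from the node of the periodic path, hence to that path itself.\<close>

lemma orbits_of_periodic_point:
  assumes real: "realization n A I" and a: "a \<in> paths A i" and q: "has_period q a"
    and irr: "\<not> ratpt (cf_point I a)"
  shows "orbits (Fmap n A I) (cf_point I a) = {\<lambda>t. cf_point I (shift t a)}"
proof -
  have "y = (\<lambda>t. cf_point I (shift t a))" if y: "y \<in> orbits (Fmap n A I) (cf_point I a)" for y
  proof -
    have H: "cf_point I a \<in> H_set A I i" using a by (auto simp: H_set_def)
    obtain b where b: "b \<in> paths A i" "\<forall>t. cf_point I (shift t b) = y t"
      by (rule orbit_lift [OF real y path_start [OF a] H])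
    have "cf_point I a = cf_point I b" using b(2) [rule_format, of 0] y by (simp add: orbits_def)
    then have "b = a" using periodic_expansion_unique [OF a b(1) _ irr q] by blast
    then show ?thesis using b(2) by (intro ext) simp
  qed
  then show ?thesis using path_orbit [OF a] by blast
qed

lemma periodic_orbit_unique:
  assumes real: "realization n A I" and irr: "\<not> ratpt x0"
    and x: "x \<in> orbits (Fmap n A I) x0" "purely_periodic x"
  obtains i a q where "i < n" "a \<in> paths A i" "has_period q a" "cf_point I a = x0"
    "x = (\<lambda>t. cf_point I (shift t a))" "orbits (Fmap n A I) x0 = {x}"
proof -
  obtain p where p: "has_period p x" using x(2) purely_periodic_iff by blast
  obtain i a q where a: "i < n" "a \<in> paths A i" "has_period q a" "\<forall>t. cf_point I (shift t a) = x t"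
    by (rule periodic_orbit_lift [OF real x(1) p irr])
  have x0: "cf_point I a = x0" using a(4) [rule_format, of 0] x(1) by (simp add: orbits_def)
  have xa: "x = (\<lambda>t. cf_point I (shift t a))" using a(4) by (simp add: fun_eq_iff del: shift_apply)
  have "orbits (Fmap n A I) x0 = {x}"
    using orbits_of_periodic_point [OF real a(2,3)] irr unfolding x0 xa by blast
  then show ?thesis using that a x0 xa by blast
qed

lemma periodic_orbit_reduced:
  assumes a: "a \<in> paths A i" and q: "has_period q a" and irr: "\<not> ratpt (cf_point I a)"
  shows "quad_pt (cf_point I a)" "p1_conj (cf_point I a) \<in> K_set A I i"
  using reversed_loop_conjugate(1) [OF a q irr] reflect_paths [OF a q] unfolding K_set_def
  by (auto simp: image_iff) (metis)

text \<open>
  The conjugate of a periodic path's point is the point of the reversed path, in both directions;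
  so uniqueness of the expansion of \<open>x\<close> gives uniqueness of the periodic expansion of its conjugate.
\<close>

lemma reduced_symbolic_periods:
  assumes quad: "quad_pt x" and H: "x \<in> H_set A I i" and K: "p1_conj x \<in> K_set A I i"
  obtains a where "a \<in> paths A i" "purely_periodic a" "cf_point I a = x"
    "symbolic_periods (symbolic_orbits A I (i, x)) = {map a [0..<period a]}"
    "symbolic_periods (symbolic_orbits_dual A I (i, p1_conj x)) = {rev (map a [0..<period a])}"
proof -
  obtain a where a: "a \<in> paths A i" "cf_point I a = x" using H by (auto simp: H_set_def)
  obtain b where b: "b \<in> rev_paths A i" "cf_point_dual I b = p1_conj x" using K by (auto simp: K_set_def)
  have pp: "purely_periodic a" using reduced_point_periodic [OF a(1) b(1)] quad a b by simp
  define p where "p = period a"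
  have p: "has_period p a" unfolding p_def by (rule has_period_period [OF pp])
  have irr: "\<not> ratpt x" "\<not> ratpt (p1_conj x)" using quad quad_pt_conj quad_pt_not_ratpt by blast+
  have uniq: "c = a" if "c \<in> paths A i" "cf_point I c = x" for c
    using periodic_expansion_unique [OF a(1) that(1) _ _ p] that(2) a(2) irr(1) by metis
  have "symbolic_orbits A I (i, x) = {a}"
    unfolding symbolic_orbits_def fst_conv snd_conv using a uniq by blast
  then have "{a \<in> symbolic_orbits A I (i, x). purely_periodic a} = {a}" using pp by auto
  then have S: "symbolic_periods (symbolic_orbits A I (i, x)) = {map a [0..<p]}"
    by (simp add: symbolic_periods_image p_def)
  let ?r = "reflect (-1) p a"
  have "{b \<in> symbolic_orbits_dual A I (i, p1_conj x). purely_periodic b} = {?r}"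
  proof (intro subset_antisym subsetI)
    fix b assume "b \<in> {b \<in> symbolic_orbits_dual A I (i, p1_conj x). purely_periodic b}"
    then obtain q where b: "b \<in> rev_paths A i" "cf_point_dual I b = p1_conj x" and q: "has_period q b"
      by (auto simp: symbolic_orbits_dual_def purely_periodic_iff)
    let ?c = "reflect (-1) q b"
    have c: "?c \<in> paths A i" by (rule reflect_rev_paths [OF b(1) q])
    have qc: "has_period q ?c" by (rule reflect_has_period [OF q q])
    have rc: "reflect (-1) q ?c = b" by (rule reflect_reflect [OF q])
    have "cf_point I ?c = p1_conj (p1_conj x)"
      using reversed_loop_conjugate(2) [OF c qc] irr(2) b(2) unfolding rc by simp
    then have ca: "?c = a" using uniq [OF c] quad_pt_conj(2) [OF quad] by simp
    have "b = reflect (-1) q a" using rc unfolding ca by simp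
    also have "\<dots> = ?r" using qc p unfolding ca by (rule reflect_indep)
    finally show "b \<in> {?r}" by simp
  next
    fix b assume "b \<in> {?r}"
    then show "b \<in> {b \<in> symbolic_orbits_dual A I (i, p1_conj x). purely_periodic b}"
      using reversed_loop_conjugate(1) [OF a(1) p] reflect_paths [OF a(1) p] reflect_has_period [OF p p] irr a(2)
      by (auto simp: symbolic_orbits_dual_def purely_periodic_iff)
  qed
  then have "symbolic_periods (symbolic_orbits_dual A I (i, p1_conj x)) = {map ?r [0..<period ?r]}"
    by (simp add: symbolic_periods_image)
  also have "map ?r [0..<period ?r] = rev (map a [0..<p])"
    using period_reflect [OF p] by (simp add: p_def map_reflect)
  finally show ?thesis using that a pp S unfolding p_def by blast
qed

text \<open>
  A periodic orbit of the dual map lifts to a path, whose reversal has the conjugate points.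
  Going one step back along the one and one step forward along the other applies the same matrix to both.
\<close>

lemma dual_orbit_formula:
  assumes real: "realization n A I" and dual: "realization n (edge_sharp ` A) (\<lambda>i. I i ** S0)"
    and quad: "quad_pt x0" and x: "x \<in> orbits (Fmap n A I) x0" "purely_periodic x"
    and y: "y \<in> orbits (Fmap_dual n A I) (p1_conj x0)" "purely_periodic y"
  shows "y t = p1_conj (reflect 0 (period x) x t)" "quad_pt (x t)"
proof -
  have irr: "\<not> ratpt x0" "\<not> ratpt (p1_conj x0)" using quad quad_pt_conj quad_pt_not_ratpt by blast+
  obtain p where p: "has_period p y" using y(2) purely_periodic_iff by blast
  obtain k b' q where b': "k < n" "b' \<in> paths (edge_sharp ` A) k" "has_period q b'"
      "\<forall>t. cf_point (\<lambda>i. I i ** S0) (shift t b') = y t"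
    by (rule dual.periodic_orbit_lift [OF dual y(1) [unfolded Fmap_dual_eq] p irr(2)])
  define b where "b = edge_sharp \<circ> b'"
  have b'b: "b' = edge_sharp \<circ> b" by (simp add: b_def fun_eq_iff)
  have b: "b \<in> rev_paths A k" using b'(2) rev_paths_sharp b'b by metis
  have q: "has_period q b" using b'(3) by (simp add: b_def has_period_def)
  have bA: "b t \<in> A" for t using b by (simp add: rev_paths_def)
  have yb: "y t = cf_point_dual I (shift t b)" for t
    using b'(4) [rule_format, of t] unfolding b'b shift_comp
    by (simp add: cf_point_dual_sharp [OF rev_paths_shift [OF b]] del: shift_apply)
  define c where "c = reflect (-1) q b"
  have c: "c \<in> paths A k" unfolding c_def by (rule reflect_rev_paths [OF b q])
  have qc: "has_period q c" unfolding c_def by (rule reflect_has_period [OF q q])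
  have rc: "reflect (-1) q c = b" unfolding c_def by (rule reflect_reflect [OF q])
  have y0: "y 0 = p1_conj x0" using y by (simp add: orbits_def)
  then have x0: "cf_point I c = x0"
    using reversed_loop_conjugate(2) [OF c qc] irr(2) yb [of 0] quad_pt_conj(2) [OF quad]
    unfolding rc by simp
  have xc: "x = (\<lambda>t. cf_point I (shift t c))"
    using orbits_of_periodic_point [OF real c qc] irr x(1) unfolding x0 by blast
  have qx: "has_period q x" unfolding xc by (rule path_orbit_periodic [OF qc])
  have Px: "has_period (period x) x" by (rule has_period_period [OF x(2)])
  define z where "z = reflect 0 q x"
  have zt: "z t = x (nat ((- int t) mod int q))" for t by (simp add: z_def reflect_def)
  have zs: "z (Suc t) = mobius (Bmat I (b t)) (z t)" for t
  proof -
    let ?s = "nat ((- int (Suc t)) mod int q)"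
    have "c ?s = c (nat ((- 1 - int t) mod int q))" by (simp add: algebra_simps)
    also have "\<dots> = b t" using rc by (auto simp: reflect_def fun_eq_iff)
    finally have "z (Suc t) = mobius (Bmat I (b t)) (x (Suc ?s))"
      unfolding zt xc using cf_point_shift [OF c, of ?s] by simp
    also have "x (Suc ?s) = z t"
      using has_period_Suc_mod [OF qx, of "- int (Suc t)"] by (simp add: zt)
    finally show ?thesis .
  qed
  have main: "quad_pt (z t) \<and> y t = p1_conj (z t)" for t
  proof (induction t)
    case 0
    have "z 0 = x0" using x by (simp add: zt orbits_def)
    then show ?case using quad y0 by simp
  next
    case (Suc t)
    then show ?case
      using quad_pt_mobius [OF gl2_Bmat [OF bA]] cf_point_dual_shift [OF b, of t]
      by (simp add: zs yb del: shift_apply)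
  qed
  show "y t = p1_conj (reflect 0 (period x) x t)"
    using main [of t] reflect_indep [OF qx Px] by (simp add: z_def)
  have "x = reflect 0 q z" unfolding z_def using reflect_reflect [OF qx] by simp
  then have "x t = z (nat ((0 - int t) mod int q))" by (metis reflect_def)
  then show "quad_pt (x t)" using main by simp
qed

text \<open>
  The formula determines every purely periodic orbit of the dual map.  Such an orbit exists since the
  reversal of a periodic lift of \<open>x\<close> is a path of the dual.
\<close>

lemma dual_orbit_unique:
  assumes real: "realization n A I" and dual: "realization n (edge_sharp ` A) (\<lambda>i. I i ** S0)"
    and quad: "quad_pt x0" and x: "x \<in> orbits (Fmap n A I) x0" "purely_periodic x"
  obtains y where "{y \<in> orbits (Fmap_dual n A I) (p1_conj x0). purely_periodic y} = {y}"
    "period y = period x" "\<forall>t. y t = p1_conj (reflect 0 (period x) x t)"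
proof -
  have irr: "\<not> ratpt x0" using quad quad_pt_not_ratpt by blast
  obtain i a q where a: "i < n" "a \<in> paths A i" "has_period q a" "cf_point I a = x0"
    "x = (\<lambda>t. cf_point I (shift t a))" "orbits (Fmap n A I) x0 = {x}"
    by (rule periodic_orbit_unique [OF real irr x])
  define b where "b = reflect (-1) q a"
  have b: "b \<in> rev_paths A i" unfolding b_def by (rule reflect_paths [OF a(2,3)])
  have qb: "has_period q (edge_sharp \<circ> b)"
    using reflect_has_period [OF a(3,3)] by (simp add: b_def has_period_def)
  have b': "edge_sharp \<circ> b \<in> paths (edge_sharp ` A) i" using b rev_paths_sharp by blast
  define y where "y t = cf_point (\<lambda>i. I i ** S0) (shift t (edge_sharp \<circ> b))" for t
  have "cf_point_dual I b = p1_conj x0"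
    using reversed_loop_conjugate(1) [OF a(2,3)] irr a(4) by (simp add: b_def)
  then have y: "y \<in> orbits (Fmap_dual n A I) (p1_conj x0)"
    using dual.path_orbit [OF b'] cf_point_dual_sharp [OF b] by (simp add: y_def [abs_def] Fmap_dual_eq)
  have pp: "purely_periodic y"
    unfolding y_def [abs_def] purely_periodic_iff using dual.path_orbit_periodic [OF qb] by blast
  note formula = dual_orbit_formula [OF real dual quad x]
  have "y' = y" if "y' \<in> orbits (Fmap_dual n A I) (p1_conj x0)" "purely_periodic y'" for y'
    using formula(1) [OF that] formula(1) [OF y pp] by (simp add: fun_eq_iff)
  then have single: "{y \<in> orbits (Fmap_dual n A I) (p1_conj x0). purely_periodic y} = {y}"
    using y pp by blast
  have P: "has_period (period x) x" by (rule has_period_period [OF x(2)])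
  let ?z = "reflect 0 (period x) x"
  have "quad_pt (?z t)" for t using formula(2) [OF y pp] by (simp add: reflect_def)
  then have "p1_conj (?z s) = p1_conj (?z t) \<longleftrightarrow> ?z s = ?z t" for s t by (metis quad_pt_conj(2))
  then have "has_period r y \<longleftrightarrow> has_period r ?z" for r
    by (simp add: has_period_def formula(1) [OF y pp])
  then have "period y = period ?z" by (simp add: period_alt)
  then have "period y = period x" by (simp add: period_reflect [OF P])
  then show ?thesis using that single formula(1) [OF y pp] by blast
qed

end

theorem theorem5p1:
  fixes n :: nat
    and A :: "edge set"
    and I :: "nat \<Rightarrow> int^2^2"
    and \<omega> :: real
  assumes "abstract_cf n A"
    and "\<forall>i < n. unimodular (I i)"
    and "realization n A I"
    and "Fin \<omega> \<in> (\<Union>i<n. H_set A I i)"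
    and "\<omega> \<notin> \<rat>"
  shows
    "((\<exists>x \<in> orbits (Fmap n A I) (Fin \<omega>). purely_periodic x) \<longleftrightarrow>
      (\<exists>x. orbits (Fmap n A I) (Fin \<omega>) = {x} \<and> purely_periodic x)) \<and>
     ((\<exists>x \<in> orbits (Fmap n A I) (Fin \<omega>). purely_periodic x) \<longleftrightarrow>
      quadratic_irrational \<omega> \<and>
      (\<exists>i0 < n. Fin \<omega> \<in> H_set A I i0 \<and> Fin (galois_conj \<omega>) \<in> K_set A I i0)) \<and>
     ((\<exists>x \<in> orbits (Fmap n A I) (Fin \<omega>). purely_periodic x) \<longrightarrow>
      (\<forall>i0 < n. Fin \<omega> \<in> H_set A I i0 \<and> Fin (galois_conj \<omega>) \<in> K_set A I i0 \<longrightarrow>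
        (\<exists>w. symbolic_periods (symbolic_orbits A I (i0, Fin \<omega>)) = {w} \<and>
             symbolic_periods (symbolic_orbits_dual A I (i0, Fin (galois_conj \<omega>))) = {rev w})) \<and>
      (geometric n A I \<longrightarrow>
        (\<forall>x \<in> orbits (Fmap n A I) (Fin \<omega>). purely_periodic x \<longrightarrow>
          (\<exists>y. {y \<in> orbits (Fmap_dual n A I) (Fin (galois_conj \<omega>)). purely_periodic y} = {y} \<and>
               period y = period x \<and>
               (\<forall>t. y t = p1_conj (x (nat ((- int t) mod int (period x)))))))))"
proof -
  interpret cf_system n A I
    using assms(1,2) by unfold_locales (auto simp: abstract_cf_def gl2_unimodular)
  note real = assms(3)
  have irr: "\<not> ratpt (Fin \<omega>)" using assms(5) by (simp add: ratpt_Fin)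
  have conj: "Fin (galois_conj \<omega>) = p1_conj (Fin \<omega>)" by simp
  let ?P = "\<exists>x \<in> orbits (Fmap n A I) (Fin \<omega>). purely_periodic x"
  let ?R = "quadratic_irrational \<omega> \<and>
      (\<exists>i0 < n. Fin \<omega> \<in> H_set A I i0 \<and> Fin (galois_conj \<omega>) \<in> K_set A I i0)"
  have unique: "orbits (Fmap n A I) (Fin \<omega>) = {x}"
    if x: "x \<in> orbits (Fmap n A I) (Fin \<omega>)" "purely_periodic x" for x
    by (rule periodic_orbit_unique [OF real irr x])
  have reduced: ?R if x: "x \<in> orbits (Fmap n A I) (Fin \<omega>)" "purely_periodic x" for x
  proof -
    obtain i a q where a: "i < n" "a \<in> paths A i" "has_period q a" "cf_point I a = Fin \<omega>"
      "x = (\<lambda>t. cf_point I (shift t a))" "orbits (Fmap n A I) (Fin \<omega>) = {x}"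
      by (rule periodic_orbit_unique [OF real irr x])
    have "Fin \<omega> \<in> H_set A I i" using a(2,4) by (force simp: H_set_def)
    moreover have "quad_pt (Fin \<omega>)" "Fin (galois_conj \<omega>) \<in> K_set A I i"
      using periodic_orbit_reduced [OF a(2,3)] irr by (simp_all add: a(4))
    ultimately show ?thesis using a(1) by auto
  qed
  have periodic: ?P if R: ?R
  proof -
    obtain i where i: "quad_pt (Fin \<omega>)" "Fin \<omega> \<in> H_set A I i" "p1_conj (Fin \<omega>) \<in> K_set A I i"
      using R by auto
    obtain a where a: "a \<in> paths A i" "purely_periodic a" "cf_point I a = Fin \<omega>"
      "symbolic_periods (symbolic_orbits A I (i, Fin \<omega>)) = {map a [0..<period a]}"
      "symbolic_periods (symbolic_orbits_dual A I (i, p1_conj (Fin \<omega>))) = {rev (map a [0..<period a])}"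
      by (rule reduced_symbolic_periods [OF i])
    have "purely_periodic (\<lambda>t. cf_point I (shift t a))"
      using a(2) path_orbit_periodic unfolding purely_periodic_iff by blast
    then show ?P using path_orbit [OF a(1)] a(3) by metis
  qed
  have symbolic: "\<exists>w. symbolic_periods (symbolic_orbits A I (i, Fin \<omega>)) = {w} \<and>
      symbolic_periods (symbolic_orbits_dual A I (i, Fin (galois_conj \<omega>))) = {rev w}"
    if P: ?P and i: "Fin \<omega> \<in> H_set A I i" "Fin (galois_conj \<omega>) \<in> K_set A I i" for i
  proof -
    have "quad_pt (Fin \<omega>)" using P reduced by auto
    obtain a where "a \<in> paths A i" "purely_periodic a" "cf_point I a = Fin \<omega>"
      "symbolic_periods (symbolic_orbits A I (i, Fin \<omega>)) = {map a [0..<period a]}"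
      "symbolic_periods (symbolic_orbits_dual A I (i, p1_conj (Fin \<omega>))) = {rev (map a [0..<period a])}"
      by (rule reduced_symbolic_periods [OF \<open>quad_pt (Fin \<omega>)\<close> i [unfolded conj]])
    then show ?thesis unfolding conj by blast
  qed
  have dual_orbit: "\<exists>y. {y \<in> orbits (Fmap_dual n A I) (Fin (galois_conj \<omega>)). purely_periodic y} = {y} \<and>
      period y = period x \<and> (\<forall>t. y t = p1_conj (x (nat ((- int t) mod int (period x)))))"
    if geo: "geometric n A I" and x: "x \<in> orbits (Fmap n A I) (Fin \<omega>)" "purely_periodic x" for x
  proof -
    have quad: "quad_pt (Fin \<omega>)" using reduced [OF x] by simp
    have dual: "realization n (edge_sharp ` A) (\<lambda>i. I i ** S0)" using geo by (simp add: geometric_def)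
    obtain y where "{y \<in> orbits (Fmap_dual n A I) (p1_conj (Fin \<omega>)). purely_periodic y} = {y}"
      "period y = period x" "\<forall>t. y t = p1_conj (reflect 0 (period x) x t)"
      by (rule dual_orbit_unique [OF real dual quad x])
    then show ?thesis unfolding conj by (intro exI [of _ y]) (simp add: reflect_def)
  qed
  show ?thesis
    using unique reduced periodic symbolic dual_orbit by (intro conjI) blast+
qed

end
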